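(* Let $K$ be a knot in $\mathbb{R}^3$. Then there is a smooth parametrisation $f:S^1\to\mathbb{R}^3$ of $K$ such that the resulting sequence of knots $(K_n)_{n\in\mathbb{N}}$, where $K_n$ is parametrised by the $n$th derivative $f^{(n)}$, converges to the unknot.
   Context: $\mathbb{N}=\{1,2,3,\ldots\}$ and $S^1\cong\mathbb{R}/2\pi\mathbb{Z}$; derivatives are with respect to $t\in\mathbb{R}/2\pi\mathbb{Z}$, taken coordinatewise. All knots are smooth knots in $\mathbb{R}^3$: a knot is the image of a smooth embedding $S^1\to\mathbb{R}^3$ (an injective smooth map with nowhere vanishing derivative). A smooth map $S^1\to\mathbb{R}^3$ parametrises a knot if it is such an embedding, and it is a parametrisation of $K$ if moreover its image is ambient isotopic to $K$. The sequence $(K_n)_{n\in\mathbb{N}}$ converges to a knot $L$ if for all sufficiently large $n$ the map $f^{(n)}$ parametrises a knot $K_n$ that is ambient isotopic to $L$. *)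

theory Defs
  imports "HOL-Analysis.Analysis"
begin

text \<open>Maps from the circle \<open>\<real>/2\<pi>\<int>\<close> to \<open>\<real>\<^sup>3\<close> are represented by \<open>2\<pi>\<close>-periodic functions on \<open>\<real>\<close>.
  All derivatives are taken on \<open>\<real>\<close>; for a smooth function they are again \<open>2\<pi>\<close>-periodic.\<close>

definition nth_derivative :: "nat \<Rightarrow> (real \<Rightarrow> 'a::real_normed_vector) \<Rightarrow> real \<Rightarrow> 'a" where
  "nth_derivative n f = ((\<lambda>g t. vector_derivative g (at t)) ^^ n) f"

text \<open>\<^const>\<open>vector_derivative\<close> is total, so \<open>nth_derivative n f\<close> is the actual derivative only
  because all lower ones are required to be differentiable here.\<close>

definition smooth :: "(real \<Rightarrow> 'a::real_normed_vector) \<Rightarrow> bool" where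
  "smooth f \<longleftrightarrow> (\<forall>n t. nth_derivative n f differentiable (at t))"

text \<open>Injectivity on the circle is injectivity on a half-open period.\<close>

definition smooth_embedding :: "(real \<Rightarrow> real ^ 3) \<Rightarrow> bool" where
  "smooth_embedding f \<longleftrightarrow>
     (\<forall>t. f (t + 2 * pi) = f t) \<and> smooth f \<and>
     inj_on f {0..<2 * pi} \<and> (\<forall>t. vector_derivative f (at t) \<noteq> 0)"

definition knot :: "(real ^ 3) set \<Rightarrow> bool" where
  "knot K \<longleftrightarrow> (\<exists>f. smooth_embedding f \<and> range f = K)"

text \<open>An ambient isotopy is a homotopy through homeomorphisms of \<open>\<real>\<^sup>3\<close> that starts at the identity
  and whose final map carries the first set onto the second.\<close>

definition ambient_isotopic :: "(real ^ 3) set \<Rightarrow> (real ^ 3) set \<Rightarrow> bool" where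
  "ambient_isotopic A B \<longleftrightarrow>
     (\<exists>\<phi>. homotopic_with_canon (\<lambda>h. \<exists>k. homeomorphism UNIV UNIV h k) UNIV UNIV id \<phi> \<and> \<phi> ` A = B)"

definition parametrisation_of :: "(real \<Rightarrow> real ^ 3) \<Rightarrow> (real ^ 3) set \<Rightarrow> bool" where
  "parametrisation_of f K \<longleftrightarrow> smooth_embedding f \<and> ambient_isotopic (range f) K"

definition derivative_knots_converge_to :: "(real \<Rightarrow> real ^ 3) \<Rightarrow> (real ^ 3) set \<Rightarrow> bool" where
  "derivative_knots_converge_to f L \<longleftrightarrow>
     (\<forall>\<^sub>F n in sequentially. parametrisation_of (nth_derivative n f) L)"

definition unknot :: "(real ^ 3) set" where
  "unknot = range (\<lambda>t. vector [cos t, sin t, 0])"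

end

theory Submission
  imports Defs
begin

text \<open>Differentiation multiplies the harmonic of frequency \<open>k\<close> by \<open>k\<close>. If the coordinates of \<open>f\<close> are
trigonometric polynomials, then after rescaling the coordinates separately (an ambient isotopy) the
derivatives \<open>f\<^sup>(\<^sup>n\<^sup>)\<close> approach, in \<open>C\<^sup>1\<close>, the curve formed by the three harmonics of highest frequency.
These three harmonics may be chosen freely: every knot has a parametrisation by trigonometric
polynomials, and adding a small multiple of further harmonics does not change the knot. It remains to find
three harmonics, of arbitrarily high frequencies, whose curve is an unknot, also after the
phase shift by \<open>n\<pi>/2\<close> that \<open>n\<close> differentiations cause.

The frequencies \<open>4q + 1\<close>, \<open>2q + 1\<close>, \<open>q\<close> with phases \<open>4p\<close>, \<open>2p\<close>, \<open>p\<close> do this. Write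
\<open>a = (2q + 1)t + 2p\<close> and \<open>b = qt + p\<close>. The first coordinate is \<open>\<plusminus>cos (a + 2b)\<close>, and since
\<open>cos (a + 2b) + cos (a - 2b) = 2 cos a (2 cos\<^sup>2 b - 1)\<close> is a polynomial in the other two coordinates, a shear
turns it into \<open>\<mp>cos (a - 2b) = \<mp>cos t\<close>. Further shears by polynomials in \<open>cos t\<close> and in one
other coordinate turn the remaining coordinates into a multiple of \<open>sin t\<close> and \<open>0\<close>; the curve has
become an ellipse (\<open>lissajous_unknot\<close>). If \<open>a\<close> and \<open>b\<close> both grow by \<open>n\<pi>/2\<close>, then \<open>a + 2b\<close> grows by
\<open>n\<pi>/2 + n\<pi>\<close>; hence shifting the phases of all three coordinates by \<open>n\<pi>/2\<close> gives a curve of the same kind, up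
to a translation of the parameter, with another \<open>p\<close> and another sign (\<open>top_curve_eq_lissajous\<close>).

Both uses of closeness, namely that \<open>f\<close> is a parametrisation of \<open>K\<close> and that \<open>f\<^sup>(\<^sup>n\<^sup>)\<close> is unknotted for large
\<open>n\<close>, rest on \<open>C1_close_to_embedding\<close>: a smooth closed curve that is \<open>C\<^sup>1\<close>-close to a smooth embedding \<open>g\<close>
is an embedding with ambient isotopic image. The reason is that the displacement of one curve to the other
is a Lipschitz map with small constant on a subset of \<open>\<real>\<^sup>3\<close>; it extends to all of \<open>\<real>\<^sup>3\<close>, and a
Lipschitz perturbation of the identity with constant below \<open>1\<close> is a homeomorphism.\<close>

section \<open>Ambient isotopies\<close>

lemma ambient_isotopicI:
  fixes H :: "real \<Rightarrow> real^3 \<Rightarrow> real^3"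
  assumes cont: "continuous_on ({0..1} \<times> UNIV) (\<lambda>p. H (fst p) (snd p))"
    and zero: "\<And>x. H 0 x = x"
    and homeo: "\<And>s. 0 \<le> s \<Longrightarrow> s \<le> 1 \<Longrightarrow> \<exists>k. homeomorphism UNIV UNIV (H s) k"
    and one: "H 1 ` A = B"
  shows "ambient_isotopic A B"
proof -
  have "homotopic_with_canon (\<lambda>h. \<exists>k. homeomorphism UNIV UNIV h k) UNIV UNIV id (H 1)"
    unfolding homotopic_with_def
  proof (intro exI[of _ "\<lambda>p. H (fst p) (snd p)"] conjI ballI allI)
    show "continuous_map (prod_topology (top_of_set {0..1}) (top_of_set UNIV)) (top_of_set UNIV)
            (\<lambda>p. H (fst p) (snd p))"
      unfolding prod_topology_subtopology_eu using cont by simp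
  qed (use zero homeo in auto)
  then show ?thesis
    unfolding ambient_isotopic_def using one by blast
qed

lemma ambient_isotopic_trans:
  assumes "ambient_isotopic A B" and "ambient_isotopic B C"
  shows "ambient_isotopic A C"
proof -
  let ?P = "\<lambda>h :: real^3 \<Rightarrow> real^3. \<exists>k. homeomorphism UNIV UNIV h k"
  obtain \<phi> where \<phi>: "homotopic_with_canon ?P UNIV UNIV id \<phi>" "\<phi> ` A = B"
    using assms(1) unfolding ambient_isotopic_def by blast
  obtain \<psi> where \<psi>: "homotopic_with_canon ?P UNIV UNIV id \<psi>" "\<psi> ` B = C"
    using assms(2) unfolding ambient_isotopic_def by blast
  have P: "?P \<phi>" and cont: "continuous_on UNIV \<phi>"
    using homotopic_with_imp_property[OF \<phi>(1)] homotopic_with_imp_continuous[OF \<phi>(1)] by auto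
  have "homotopic_with_canon ?P UNIV UNIV (id \<circ> \<phi>) (\<psi> \<circ> \<phi>)"
  proof (rule homotopic_with_compose_continuous_map_right[OF \<psi>(1)])
    show "continuous_map (top_of_set UNIV) (top_of_set UNIV) \<phi>"
      using cont by simp
    show "?P (j \<circ> \<phi>)" if "?P j" for j
      using that P homeomorphism_compose by blast
  qed
  then have "homotopic_with_canon ?P UNIV UNIV id (\<psi> \<circ> \<phi>)"
    using \<phi>(1) homotopic_with_trans by fastforce
  then show ?thesis
    unfolding ambient_isotopic_def using \<phi>(2) \<psi>(2) by (metis image_comp)
qed

text \<open>Shears along a direction in which \<open>h\<close> is constant are inverted by subtracting what was added, and
the shears by \<open>s h\<close> join them to the identity.\<close>

lemma ambient_isotopic_shear:
  fixes h :: "real^3 \<Rightarrow> real"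
  assumes cont: "continuous_on UNIV h" and indep: "\<And>x c. h (x + c *\<^sub>R e) = h x"
  shows "ambient_isotopic A ((\<lambda>x. x + h x *\<^sub>R e) ` A)"
proof (rule ambient_isotopicI[where H = "\<lambda>s x. x + (s * h x) *\<^sub>R e"])
  have h: "continuous_on T (\<lambda>x. h (k x))" if "continuous_on T k" for T :: "'b::topological_space set" and k
    using continuous_on_compose2[OF cont that] by simp
  show "continuous_on ({0..1} \<times> UNIV) (\<lambda>p. snd p + (fst p * h (snd p)) *\<^sub>R e)"
    by (intro continuous_intros h)
  show "\<exists>k. homeomorphism UNIV UNIV (\<lambda>x. x + (s * h x) *\<^sub>R e) k" for s
  proof (intro exI)
    have inv: "h (x - c *\<^sub>R e) = h x" for x c
      using indep[of x "-c"] by simp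
    have h2: "continuous_on UNIV h" using cont .
    show "homeomorphism UNIV UNIV (\<lambda>x. x + (s * h x) *\<^sub>R e) (\<lambda>x. x - (s * h x) *\<^sub>R e)"
      by (intro homeomorphismI continuous_intros h2) (auto simp: indep inv)
  qed
qed auto

lemma ambient_isotopic_scale:
  fixes c :: "real^3"
  assumes pos: "\<And>i. c $ i > 0"
  shows "ambient_isotopic A ((\<lambda>x. \<chi> i. c $ i * x $ i) ` A)"
proof (rule ambient_isotopicI[where H = "\<lambda>s x. \<chi> i. (1 - s + s * c $ i) * x $ i"])
  show "continuous_on ({0..1} \<times> UNIV) (\<lambda>p. \<chi> i. (1 - fst p + fst p * c $ i) * snd p $ i)"
    by (intro continuous_intros)
  fix s :: real assume s: "0 \<le> s" "s \<le> 1"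
  have ne: "1 - s + s * c $ i > 0" for i
    using pos[of i] s by (cases "s = 1") (auto intro!: add_pos_nonneg)
  have ne': "1 - s + s * c $ i \<noteq> 0" for i
    using ne[of i] by simp
  show "\<exists>k. homeomorphism UNIV UNIV (\<lambda>x. \<chi> i. (1 - s + s * c $ i) * x $ i :: real^3) k"
  proof (intro exI)
    show "homeomorphism UNIV UNIV (\<lambda>x. \<chi> i. (1 - s + s * c $ i) * x $ i :: real^3)
            (\<lambda>x. \<chi> i. x $ i / (1 - s + s * c $ i))"
      by (intro homeomorphismI continuous_intros)
        (use ne' in \<open>auto simp: vec_eq_iff\<close>)
  qed
qed (auto simp: vec_eq_iff)

text \<open>McShane's extension: the greatest \<open>L\<close>-Lipschitz function that agrees with \<open>v\<close> on \<open>S\<close>, as an infimum of cones.\<close>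

lemma lipschitz_extension_real:
  fixes v :: "'a::metric_space \<Rightarrow> real"
  assumes lip: "\<And>x y. x \<in> S \<Longrightarrow> y \<in> S \<Longrightarrow> \<bar>v x - v y\<bar> \<le> L * dist x y" and L: "0 \<le> L"
  obtains V where "\<And>x. x \<in> S \<Longrightarrow> V x = v x" and "\<And>x y. \<bar>V x - V y\<bar> \<le> L * dist x y"
proof (cases "S = {}")
  case True
  then show ?thesis using that[of "\<lambda>_. 0"] L by simp
next
  case False
  define V where "V x = (INF y\<in>S. v y + L * dist x y)" for x
  have bdd: "bdd_below ((\<lambda>y. v y + L * dist x y) ` S)" for x
  proof -
    obtain z where z: "z \<in> S" using False by auto
    have "v z - L * dist x z \<le> v y + L * dist x y" if "y \<in> S" for y
    proof -
      have "v z - v y \<le> L * dist z y" using lip[OF z that] by simp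
      also have "\<dots> \<le> L * (dist x z + dist x y)"
        using L by (intro mult_left_mono) (auto simp: dist_triangle3)
      finally show ?thesis by (simp add: algebra_simps)
    qed
    then show ?thesis by (intro bdd_belowI2)
  qed
  have le: "V x \<le> V z + L * dist x z" for x z
  proof -
    have "V x - L * dist x z \<le> v y + L * dist z y" if "y \<in> S" for y
    proof -
      have "V x \<le> v y + L * dist x y"
        unfolding V_def using bdd that by (rule cINF_lower)
      also have "L * dist x y \<le> L * (dist x z + dist z y)"
        using L by (intro mult_left_mono) (auto simp: dist_triangle)
      finally show ?thesis by (simp add: algebra_simps)
    qed
    then have "V x - L * dist x z \<le> V z"
      unfolding V_def[of z] using False by (intro cINF_greatest)
    then show ?thesis by simp
  qed
  show ?thesis
  proof
    show "V x = v x" if x: "x \<in> S" for x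
    proof (rule antisym)
      show "V x \<le> v x"
        unfolding V_def using cINF_lower[OF bdd x, of x] by simp
      have "v x \<le> v y + L * dist x y" if "y \<in> S" for y
        using lip[OF x that] by simp
      then show "v x \<le> V x"
        unfolding V_def using False by (intro cINF_greatest)
    qed
    show "\<bar>V x - V y\<bar> \<le> L * dist x y" for x y
      using le[of x y] le[of y x] by (simp add: dist_commute abs_le_iff)
  qed
qed

text \<open>Solving \<open>x + V x = y\<close> is a fixed point problem for the contraction \<open>x \<mapsto> y - V x\<close>; continuity of the
inverse comes from invariance of domain.\<close>

lemma homeomorphism_lipschitz_perturbation:
  fixes V :: "real^3 \<Rightarrow> real^3"
  assumes lip: "\<And>x y. norm (V x - V y) \<le> L * norm (x - y)" and L: "0 \<le> L" "L < 1"
  shows "\<exists>k. homeomorphism UNIV UNIV (\<lambda>x. x + V x) k"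
proof -
  have "L-lipschitz_on UNIV V"
    using lip L by (auto simp: lipschitz_on_def dist_norm)
  then have contV: "continuous_on UNIV V"
    by (rule lipschitz_on_continuous_on)
  have inj: "inj (\<lambda>x. x + V x)"
  proof (rule injI)
    fix x y assume "x + V x = y + V y"
    then have "x - y = V y - V x" by (simp add: algebra_simps)
    then have "norm (x - y) \<le> L * norm (x - y)" using lip[of y x] by (simp add: norm_minus_commute)
    then have "(1 - L) * norm (x - y) \<le> 0" by (simp add: algebra_simps)
    then show "x = y" using L by (simp add: mult_le_0_iff)
  qed
  have surj: "range (\<lambda>x. x + V x) = UNIV"
  proof -
    have "\<exists>x. y = x + V x" for y
    proof -
      have "\<exists>!x. y - V x = x"
        using lip L by (intro banach_fix_type[of L]) (auto simp: dist_norm norm_minus_commute)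
      then obtain x where "y - V x = x" by blast
      then show ?thesis by (metis diff_add_cancel)
    qed
    then show ?thesis by auto
  qed
  have "continuous_on UNIV (\<lambda>x. x + V x)"
    using contV by (intro continuous_intros)
  then obtain k where "homeomorphism UNIV (range (\<lambda>x. x + V x)) (\<lambda>x. x + V x) k"
    using invariance_of_domain_homeomorphism[of UNIV "\<lambda>x. x + V x"] inj by auto
  then show ?thesis using surj by auto
qed

text \<open>The displacement \<open>g - f\<close>, seen as a map on the image of \<open>f\<close>, is \<open>L\<close>-Lipschitz. Extending its three
coordinates one by one costs at most a factor \<open>3\<close>, whence the bound on \<open>3 * L\<close>; then \<open>x + s W x\<close>, with \<open>W\<close> the
extension, is the isotopy.\<close>

lemma ambient_isotopic_perturbation:
  fixes f g :: "'a \<Rightarrow> real^3"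
  assumes lip: "\<And>s t. norm ((g s - f s) - (g t - f t)) \<le> L * norm (f s - f t)"
    and L: "0 \<le> L" "3 * L < 1"
  shows "ambient_isotopic (range f) (range g)"
proof -
  define v where "v x = g (inv f x) - x" for x
  have vf: "v (f s) = g s - f s" for s
  proof -
    \<comment> \<open>The Lipschitz bound makes the displacement independent of the chosen preimage of a point.\<close>
    have "f (inv f (f s)) = f s" by (simp add: f_inv_into_f)
    then show ?thesis
      using lip[of "inv f (f s)" s] by (simp add: v_def)
  qed
  have "\<exists>V. (\<forall>x\<in>range f. V x = v x $ i) \<and> (\<forall>x y. \<bar>V x - V y\<bar> \<le> L * dist x y)" for i
  proof -
    have "\<bar>v x $ i - v y $ i\<bar> \<le> L * dist x y" if "x \<in> range f" "y \<in> range f" for x y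
    proof -
      have "\<bar>v x $ i - v y $ i\<bar> \<le> norm (v x - v y)"
        using component_le_norm_cart[of "v x - v y" i] by simp
      also have "\<dots> \<le> L * dist x y" using that lip by (auto simp: vf dist_norm)
      finally show ?thesis .
    qed
    from lipschitz_extension_real[OF this L(1)] show ?thesis by metis
  qed
  then obtain V where V: "\<And>i x. x \<in> range f \<Longrightarrow> V i x = v x $ i"
    and Vlip: "\<And>i x y. \<bar>V i x - V i y\<bar> \<le> L * dist x y"
    by metis
  define W where "W x = (\<chi> i. V i x)" for x
  have Wlip: "norm (W x - W y) \<le> 3 * L * norm (x - y)" for x y
  proof -
    have "norm (W x - W y) \<le> (\<Sum>i\<in>UNIV. \<bar>(W x - W y) $ i\<bar>)"
      by (rule norm_le_l1_cart)
    also have "\<dots> \<le> (\<Sum>i\<in>(UNIV::3 set). L * dist x y)"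
      by (intro sum_mono) (simp add: W_def Vlip)
    finally show ?thesis by (simp add: dist_norm)
  qed
  have Wf: "W (f s) = g s - f s" for s
    using V[OF rangeI[of f s]] by (simp add: W_def vf vec_eq_iff)
  have contW: "continuous_on UNIV W"
  proof -
    have "(3*L)-lipschitz_on UNIV W"
      using Wlip L by (auto simp: lipschitz_on_def dist_norm)
    then show ?thesis by (rule lipschitz_on_continuous_on)
  qed
  show ?thesis
  proof (rule ambient_isotopicI[where H = "\<lambda>s x. x + s *\<^sub>R W x"])
    show "continuous_on ({0..1} \<times> UNIV) (\<lambda>p. snd p + fst p *\<^sub>R W (snd p))"
      by (intro continuous_intros continuous_on_compose2[OF contW]) auto
    show "\<exists>k. homeomorphism UNIV UNIV (\<lambda>x. x + s *\<^sub>R W x) k" if s: "0 \<le> s" "s \<le> 1" for s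
    proof (rule homeomorphism_lipschitz_perturbation)
      show "norm (s *\<^sub>R W x - s *\<^sub>R W y) \<le> 3 * L * norm (x - y)" for x y
      proof -
        have "norm (s *\<^sub>R W x - s *\<^sub>R W y) = s * norm (W x - W y)"
          using s by (simp flip: scaleR_diff_right)
        also have "\<dots> \<le> 1 * norm (W x - W y)"
          using s by (intro mult_right_mono) auto
        finally show ?thesis using Wlip[of x y] by simp
      qed
    qed (use L in auto)
    show "(\<lambda>x. x + 1 *\<^sub>R W x) ` range f = range g"
      by (auto simp: image_image Wf)
  qed auto
qed

section \<open>Closed curves close to an embedding\<close>

lemma smooth_has_vector_derivative:
  assumes "smooth f"
  shows "(f has_vector_derivative vector_derivative f (at t)) (at t)"
proof -
  have "nth_derivative 0 f differentiable (at t)"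
    using assms unfolding smooth_def by blast
  then show ?thesis
    by (simp add: nth_derivative_def vector_derivative_works)
qed

lemma smooth_continuous_vector_derivative:
  assumes "smooth f"
  shows "continuous_on S (\<lambda>t. vector_derivative f (at t))"
proof -
  have "nth_derivative 1 f differentiable (at t)" for t
    using assms unfolding smooth_def by blast
  then have "(\<lambda>t. vector_derivative f (at t)) differentiable (at t)" for t
    by (simp add: nth_derivative_def)
  then show ?thesis
    by (intro continuous_at_imp_continuous_on ballI differentiable_imp_continuous_within)
qed

lemma periodic_int:
  fixes f :: "real \<Rightarrow> 'a"
  assumes "\<And>t. f (t + p) = f t"
  shows "f (t + of_int k * p) = f t"
proof (induction k arbitrary: t rule: int_induct[where k = 0])
  case (step1 i)
  have "f (t + of_int (i + 1) * p) = f (t + of_int i * p + p)"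
    by (simp add: algebra_simps)
  then show ?case using assms step1 by simp
next
  case (step2 i)
  have "f (t + of_int (i - 1) * p) = f (t + of_int (i - 1) * p + p)"
    using assms by simp
  also have "\<dots> = f (t + of_int i * p)" by (simp add: algebra_simps)
  finally show ?case using step2 by simp
qed simp

lemma periodic_vector_derivative:
  assumes per: "\<And>t. f (t + p) = f t"
    and der: "\<And>t. (f has_vector_derivative f' t) (at t)"
  shows "f' (t + p) = f' t"
proof -
  have "((\<lambda>t. f (t + p)) has_vector_derivative f' (t + p)) (at t)"
  proof -
    have "((\<lambda>t. t + p) has_vector_derivative 1) (at t)"
      by (auto intro!: derivative_eq_intros)
    then show ?thesis
      using vector_diff_chain_at[of "\<lambda>t. t + p" 1 t f "f' (t + p)"] der[of "t + p"]
      by (simp add: o_def)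
  qed
  then have "(f has_vector_derivative f' (t + p)) (at t)"
    by (simp add: per)
  then show ?thesis
    using der vector_derivative_unique_at by blast
qed

text \<open>Distances on the circle are measured by the chord \<open>\<bar>sin ((t - s) / 2)\<bar>\<close>, which is \<open>2\<pi>\<close>-periodic in both
arguments. Two parameters can be moved to within \<open>\<pi>\<close> of each other without changing it, and there it is
comparable with their distance on the line (see \<open>abs_le_sin_half\<close>).\<close>

lemma circle_reduction:
  fixes s t :: real
  obtains k :: int and r where "t = s + r + of_int k * (2 * pi)" and "\<bar>r\<bar> \<le> pi"
    and "\<bar>sin ((t - s) / 2)\<bar> = \<bar>sin (r / 2)\<bar>"
proof
  define k where "k = \<lfloor>(t - s) / (2 * pi) + 1 / 2\<rfloor>"
  define r where "r = t - s - of_int k * (2 * pi)"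
  show t: "t = s + r + of_int k * (2 * pi)" by (simp add: r_def)
  have "of_int k \<le> (t - s) / (2 * pi) + 1 / 2" "(t - s) / (2 * pi) + 1 / 2 < of_int k + 1"
    unfolding k_def by linarith+
  then show "\<bar>r\<bar> \<le> pi"
    by (auto simp: r_def field_simps abs_le_iff)
  have "(t - s) / 2 = r / 2 + pi * of_int k"
    by (simp add: t add_divide_distrib)
  moreover have "\<bar>cos (pi * of_int k)\<bar> = 1"
    using sin_cos_squared_add[of "pi * of_int k"] by (simp add: power2_eq_1_iff)
  ultimately show "\<bar>sin ((t - s) / 2)\<bar> = \<bar>sin (r / 2)\<bar>"
    by (simp only: sin_add abs_mult sin_npi_int mult_zero_right add_0_right mult_1_right)
qed

lemma abs_le_sin_half:
  fixes r :: real
  assumes "\<bar>r\<bar> \<le> pi"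
  shows "\<bar>r\<bar> \<le> 6 * \<bar>sin (r / 2)\<bar>"
proof -
  define x where "x = r / 2"
  have x: "\<bar>x\<bar> \<le> 2"
    using assms pi_half_less_two by (simp add: x_def)
  have "\<bar>sin x - x\<bar> \<le> \<bar>x\<bar> ^ 3 / 6"
    using Maclaurin_sin_bound[of x 3] by (simp add: sin_coeff_def numeral_eq_Suc field_simps)
  also have "\<dots> = \<bar>x\<bar> ^ 2 * \<bar>x\<bar> / 6" by (simp add: power2_eq_square power3_eq_cube)
  also have "\<dots> \<le> 2 ^ 2 * \<bar>x\<bar> / 6"
    using x by (intro divide_right_mono mult_right_mono power_mono) auto
  finally have "\<bar>x\<bar> \<le> 3 * \<bar>sin x\<bar>" by (simp add: abs_if split: if_splits)
  then show ?thesis by (simp add: x_def)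
qed

lemma periodic_lipschitz:
  fixes v :: "real \<Rightarrow> 'a::real_normed_vector"
  assumes per: "\<And>t. v (t + 2 * pi) = v t"
    and der: "\<And>t. (v has_vector_derivative v' t) (at t)"
    and bound: "\<And>t. norm (v' t) \<le> \<eta>"
  shows "norm (v t - v s) \<le> 6 * \<eta> * \<bar>sin ((t - s) / 2)\<bar>"
proof -
  have \<eta>: "0 \<le> \<eta>" using bound[of 0] norm_ge_zero order_trans by blast
  obtain k :: int and r where t: "t = s + r + of_int k * (2 * pi)" and r: "\<bar>r\<bar> \<le> pi"
    and chord: "\<bar>sin ((t - s) / 2)\<bar> = \<bar>sin (r / 2)\<bar>"
    by (rule circle_reduction)
  have "v t = v (s + r)"
    unfolding t by (rule periodic_int) (rule per)
  moreover have "norm (v (s + r) - v s) \<le> \<eta> * norm (s + r - s)"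
  proof (rule differentiable_bound[where S = UNIV and f' = "\<lambda>t h. h *\<^sub>R v' t"])
    show "(v has_derivative (\<lambda>h. h *\<^sub>R v' x)) (at x within UNIV)" for x
      using der[of x] by (simp add: has_vector_derivative_def)
    show "onorm (\<lambda>h. h *\<^sub>R v' x) \<le> \<eta>" for x
      using bound[of x] by (intro onorm_bound) (auto simp: \<eta> mult.commute[of \<eta>] intro!: mult_left_mono)
  qed auto
  ultimately have "norm (v t - v s) \<le> \<eta> * \<bar>r\<bar>" by simp
  also have "\<dots> \<le> \<eta> * (6 * \<bar>sin (r / 2)\<bar>)"
    using abs_le_sin_half[OF r] \<eta> by (rule mult_left_mono)
  finally show ?thesis using chord by simp
qed

text \<open>Near the diagonal the curve is almost straight, because its derivative is uniformly continuous and bounded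
away from \<open>0\<close>. Away from the diagonal injectivity and compactness bound the distance of two
points of the curve from below.\<close>

lemma smooth_embedding_bilipschitz:
  assumes emb: "smooth_embedding g"
  obtains c where "c > 0" and "\<And>s t. c * \<bar>sin ((t - s) / 2)\<bar> \<le> norm (g t - g s)"
proof -
  define g' where "g' t = vector_derivative g (at t)" for t
  have per: "\<And>t. g (t + 2 * pi) = g t" and inj: "inj_on g {0..<2 * pi}"
    and ne: "\<And>t. g' t \<noteq> 0" and sm: "smooth g"
    using emb unfolding smooth_embedding_def g'_def by auto
  have der: "(g has_vector_derivative g' t) (at t)" for t
    unfolding g'_def by (rule smooth_has_vector_derivative[OF sm])
  have cont: "continuous_on S g" for S
    using der by (meson continuous_on_eq_continuous_within has_vector_derivative_continuous continuous_at_imp_continuous_within)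
  have cont': "continuous_on S g'" for S
    unfolding g'_def by (rule smooth_continuous_vector_derivative[OF sm])
  have per': "g' (t + 2 * pi) = g' t" for t
    using per der by (rule periodic_vector_derivative)

  obtain z where z: "z \<in> {0..2*pi}" "\<And>t. t \<in> {0..2*pi} \<Longrightarrow> norm (g' z) \<le> norm (g' t)"
    using continuous_attains_inf[of "{0..2*pi}" "\<lambda>t. norm (g' t)"] continuous_on_norm[OF cont']
    by auto
  define m where "m = norm (g' z)"
  have m: "m > 0" using ne by (simp add: m_def)

  \<comment> \<open>A base point in the first period and a step below pi stay inside this interval.\<close>
  have "uniformly_continuous_on {0..4*pi} g'"
    using cont' by (intro compact_uniformly_continuous) auto
  then obtain \<delta>0 where \<delta>0: "\<delta>0 > 0"
    "\<And>s t. s \<in> {0..4*pi} \<Longrightarrow> t \<in> {0..4*pi} \<Longrightarrow> dist t s < \<delta>0 \<Longrightarrow> dist (g' t) (g' s) < m / 2"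
    unfolding uniformly_continuous_on_def using m by (meson half_gt_zero)
  define \<delta> where "\<delta> = min \<delta>0 pi"
  have \<delta>: "0 < \<delta>" "\<delta> \<le> pi" "\<delta> \<le> \<delta>0" using \<delta>0 by (auto simp: \<delta>_def)
  have near: "m / 2 * \<bar>sin (h / 2)\<bar> \<le> norm (g (s + h) - g s)"
    if s: "s \<in> {0..2*pi}" and h: "0 \<le> h" "h < \<delta>" for s h
  proof -
    have "norm (g (s + h) - g s - (s + h - s) *\<^sub>R g' s) \<le> norm (s + h - s) * (m / 2)"
    proof (rule vector_differentiable_bound_linearization[where S = "{s..s+h}"])
      show "(g has_vector_derivative g' x) (at x within {s..s+h})" for x
        using der has_vector_derivative_at_within by blast
      show "norm (g' x - g' s) \<le> m / 2" if "x \<in> {s..s + h}" for x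
        using \<delta>0(2)[of s x] that s h \<delta> by (auto simp: dist_norm)
    qed (use h in \<open>auto simp: closed_segment_eq_real_ivl\<close>)
    then have "norm (g (s + h) - g s - h *\<^sub>R g' s) \<le> h * (m / 2)"
      using h by simp
    moreover have "norm (h *\<^sub>R g' s) \<ge> h * m"
      using z(2)[OF s] h by (simp add: m_def mult_left_mono)
    moreover have "norm (h *\<^sub>R g' s) \<le> norm (g (s + h) - g s) + norm (g (s + h) - g s - h *\<^sub>R g' s)"
      by (metis norm_minus_commute norm_triangle_sub add.commute)
    ultimately have "norm (g (s + h) - g s) \<ge> h * m / 2" by simp
    moreover have "\<bar>sin (h / 2)\<bar> \<le> h"
      using abs_sin_le_one abs_sin_x_le_abs_x[of "h / 2"] h by simp
    then have "m / 2 * \<bar>sin (h / 2)\<bar> \<le> m / 2 * h"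
      using m by (intro mult_left_mono) auto
    ultimately show ?thesis by (simp add: mult.commute)
  qed

  let ?F = "{0..2*pi} \<times> {\<delta>..pi}"
  have "continuous_on ?F (\<lambda>p. norm (g (fst p + snd p) - g (fst p)))"
    by (intro continuous_intros continuous_on_compose2[OF cont[of UNIV]]) auto
  moreover have "compact ?F" "?F \<noteq> {}"
    using \<delta> by (auto intro: compact_Times)
  ultimately obtain w where w: "w \<in> ?F"
    "\<And>p. p \<in> ?F \<Longrightarrow> norm (g (fst w + snd w) - g (fst w)) \<le> norm (g (fst p + snd p) - g (fst p))"
    using continuous_attains_inf[of ?F] by blast
  define m2 where "m2 = norm (g (fst w + snd w) - g (fst w))"
  have ne2: "g (s + h) \<noteq> g s" if s: "s \<in> {0..2*pi}" and h: "0 < h" "h \<le> pi" for s h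
  proof
    assume eq: "g (s + h) = g s"
    define N where "N x = x - of_int \<lfloor>x / (2*pi)\<rfloor> * (2*pi)" for x :: real
    have N: "N x \<in> {0..<2*pi}" for x
    proof -
      define k where "k = \<lfloor>x / (2*pi)\<rfloor>"
      have "of_int k \<le> x / (2*pi)" "x / (2*pi) < of_int k + 1"
        unfolding k_def by linarith+
      then show ?thesis unfolding N_def k_def[symmetric] by (auto simp: field_simps)
    qed
    have gN: "g (N x) = g x" for x
      using periodic_int[of g "2*pi" x "- \<lfloor>x / (2*pi)\<rfloor>"] per by (simp add: N_def)
    have "N (s + h) = N s"
      using inj N gN eq by (metis inj_onD)
    then have "h = of_int (\<lfloor>(s + h) / (2*pi)\<rfloor> - \<lfloor>s / (2*pi)\<rfloor>) * (2*pi)"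
      by (simp add: N_def algebra_simps)
    then obtain k :: int where k: "h = of_int k * (2*pi)" by blast
    have "0 < k" using h k by (simp add: zero_less_mult_iff)
    then have "1 * (2*pi) \<le> h" unfolding k by (intro mult_right_mono) auto
    then show False using h pi_gt_zero by linarith
  qed
  have m2: "m2 > 0"
    using ne2[of "fst w" "snd w"] w(1) \<delta> by (auto simp: m2_def mem_Times_iff)
  have far: "m2 * \<bar>sin (h / 2)\<bar> \<le> norm (g (s + h) - g s)"
    if s: "s \<in> {0..2*pi}" and h: "\<delta> \<le> h" "h \<le> pi" for s h
  proof -
    have "m2 * \<bar>sin (h / 2)\<bar> \<le> m2 * 1" using m2 by (intro mult_left_mono) auto
    also have "\<dots> \<le> norm (g (s + h) - g s)"
      using w(2)[of "(s, h)"] s h by (simp add: m2_def)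
    finally show ?thesis .
  qed

  define c where "c = min (m / 2) m2"
  have c: "c > 0" "c \<le> m / 2" "c \<le> m2" using m m2 by (auto simp: c_def)
  have base: "c * \<bar>sin (h / 2)\<bar> \<le> norm (g (s + h) - g s)"
    if s: "s \<in> {0..2*pi}" and h: "0 \<le> h" "h \<le> pi" for s h
  proof (cases "h < \<delta>")
    case True
    have "c * \<bar>sin (h / 2)\<bar> \<le> m / 2 * \<bar>sin (h / 2)\<bar>" using c by (intro mult_right_mono) auto
    then show ?thesis using near[OF s h(1) True] by linarith
  next
    case False
    have "c * \<bar>sin (h / 2)\<bar> \<le> m2 * \<bar>sin (h / 2)\<bar>" using c by (intro mult_right_mono) auto
    then show ?thesis using far[OF s _ h(2)] False by auto
  qed
  \<comment> \<open>Periodicity extends the estimate from base points in one period to all base points.\<close>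
  have shifted: "c * \<bar>sin (h / 2)\<bar> \<le> norm (g (s + h) - g s)"
    if h: "0 \<le> h" "h \<le> pi" for s h
  proof -
    define k where "k = \<lfloor>s / (2*pi)\<rfloor>"
    have "of_int k \<le> s / (2*pi)" "s / (2*pi) < of_int k + 1"
      unfolding k_def by linarith+
    then have "s + of_int (-k) * (2*pi) \<in> {0..2*pi}" by (auto simp: field_simps)
    from base[OF this h] have "c * \<bar>sin (h / 2)\<bar> \<le>
        norm (g (s + h + of_int (-k) * (2*pi)) - g (s + of_int (-k) * (2*pi)))"
      by (simp add: algebra_simps)
    moreover have "g (x + of_int (-k) * (2*pi)) = g x" for x
      by (rule periodic_int) (rule per)
    ultimately show ?thesis by simp
  qed
  show thesis
  proof
    show "c > 0" by fact
    fix s t :: real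
    obtain k :: int and r where t: "t = s + r + of_int k * (2 * pi)" and r: "\<bar>r\<bar> \<le> pi"
      and chord: "\<bar>sin ((t - s) / 2)\<bar> = \<bar>sin (r / 2)\<bar>"
      by (rule circle_reduction)
    have gt: "g t = g (s + r)"
      unfolding t by (rule periodic_int) (rule per)
    show "c * \<bar>sin ((t - s) / 2)\<bar> \<le> norm (g t - g s)"
    proof (cases "r \<ge> 0")
      case True
      then show ?thesis using shifted[of r s] r chord gt by simp
    next
      case False
      then show ?thesis using shifted[of "- r" "s + r"] r chord gt by (simp add: norm_minus_commute)
    qed
  qed
qed

text \<open>A converse to the previous lemma: the chord vanishes only on the diagonal of the circle, and it has slope \<open>1/2\<close> there,
so a lower bound by the chord yields both injectivity and a nonzero derivative.\<close>

lemma smooth_embeddingI_bilipschitz: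
  assumes per: "\<And>t. f (t + 2 * pi) = f t" and sm: "smooth f"
    and c: "c > 0" "\<And>s t. c * \<bar>sin ((t - s) / 2)\<bar> \<le> norm (f t - f s)"
  shows "smooth_embedding f"
  unfolding smooth_embedding_def
proof (intro conjI allI)
  show "inj_on f {0..<2*pi}"
  proof (rule inj_onI)
    fix s t assume st: "s \<in> {0..<2*pi}" "t \<in> {0..<2*pi}" "f s = f t"
    then have "c * \<bar>sin ((t - s) / 2)\<bar> \<le> 0" using c(2)[of t s] by simp
    then have 0: "sin ((t - s) / 2) = 0" using c(1) by (simp add: mult_le_0_iff)
    show "s = t"
    proof (rule linorder_cases[of s t])
      assume "s < t"
      then have "sin ((t - s) / 2) > 0" using st by (intro sin_gt_zero) auto
      then show ?thesis using 0 by simp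
    next
      assume "t < s"
      then have "sin ((s - t) / 2) > 0" using st by (intro sin_gt_zero) auto
      moreover have "sin ((s - t) / 2) = - sin ((t - s) / 2)"
        by (metis minus_diff_eq minus_divide_left sin_minus)
      ultimately show ?thesis using 0 by simp
    qed
  qed
  show "vector_derivative f (at t) \<noteq> 0" for t
  proof
    assume "vector_derivative f (at t) = 0"
    then have "(f has_vector_derivative 0) (at t)"
      using smooth_has_vector_derivative[OF sm, of t] by simp
    then have "((\<lambda>y. norm (f y - f t) / norm (y - t)) \<longlongrightarrow> 0) (at t)"
      by (simp add: has_vector_derivative_def has_derivative_iff_norm)
    moreover have "((\<lambda>y. c * \<bar>sin ((y - t) / 2) / (y - t)\<bar>) \<longlongrightarrow> c * \<bar>1 / 2\<bar>) (at t)"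
    proof -
      have "((\<lambda>y. sin ((y - t) / 2)) has_real_derivative 1 / 2) (at t)"
        by (auto intro!: derivative_eq_intros)
      then have "((\<lambda>y. sin ((y - t) / 2) / (y - t)) \<longlongrightarrow> 1 / 2) (at t)"
        by (simp add: has_field_derivative_iff)
      then show ?thesis by (rule tendsto_mult_left[OF tendsto_rabs])
    qed
    moreover have "\<forall>\<^sub>F y in at t. c * \<bar>sin ((y - t) / 2) / (y - t)\<bar> \<le> norm (f y - f t) / norm (y - t)"
    proof (intro always_eventually allI)
      fix y
      have "c * \<bar>sin ((y - t) / 2)\<bar> / \<bar>y - t\<bar> \<le> norm (f y - f t) / \<bar>y - t\<bar>"
        using c(2) by (rule divide_right_mono) simp
      then show "c * \<bar>sin ((y - t) / 2) / (y - t)\<bar> \<le> norm (f y - f t) / norm (y - t)"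
        by simp
    qed
    ultimately have "c * \<bar>1 / 2\<bar> \<le> 0"
      by (intro tendsto_le[OF _ _ _ \<open>\<forall>\<^sub>F y in at t. _ y\<close>]) auto
    then show False using c(1) by simp
  qed
qed (use per sm in auto)

text \<open>Let \<open>c\<close> be the chord constant of \<open>g\<close>. With derivatives closer than \<open>c/48\<close> the displacement \<open>f - g\<close> varies by at
most \<open>c/8\<close> times the chord (\<open>periodic_lipschitz\<close> contributes the factor \<open>6\<close>). Hence \<open>f\<close> keeps the chord constant \<open>7c/8\<close>, and
relative to \<open>f\<close> the displacement has Lipschitz constant \<open>(c/8) / (7c/8) = 1/7\<close>, small enough for
\<open>ambient_isotopic_perturbation\<close>. Only the derivatives have to be close, as translations do not matter.\<close>

lemma C1_close_to_embedding:
  assumes emb: "smooth_embedding g"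
  obtains \<eta> where "\<eta> > 0"
    and "\<And>f. (\<And>t. f (t + 2 * pi) = f t) \<Longrightarrow> smooth f \<Longrightarrow>
           (\<And>t. norm (vector_derivative f (at t) - vector_derivative g (at t)) \<le> \<eta>) \<Longrightarrow>
           parametrisation_of f (range g)"
proof -
  obtain c where c: "c > 0" "\<And>s t. c * \<bar>sin ((t - s) / 2)\<bar> \<le> norm (g t - g s)"
    using smooth_embedding_bilipschitz[OF emb] by blast
  have gper: "g (t + 2 * pi) = g t" and gsm: "smooth g" for t
    using emb unfolding smooth_embedding_def by auto
  show thesis
  proof
    show "c / 48 > 0" using c by simp
    fix f :: "real \<Rightarrow> real^3"
    assume per: "\<And>t. f (t + 2 * pi) = f t" and sm: "smooth f"
      and close: "\<And>t. norm (vector_derivative f (at t) - vector_derivative g (at t)) \<le> c / 48"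
    have diff: "norm ((f t - g t) - (f s - g s)) \<le> 6 * (c / 48) * \<bar>sin ((t - s) / 2)\<bar>" for s t
    proof (rule periodic_lipschitz[where v = "\<lambda>t. f t - g t"])
      show "((\<lambda>t. f t - g t) has_vector_derivative
              vector_derivative f (at t) - vector_derivative g (at t)) (at t)" for t
        by (intro has_vector_derivative_diff smooth_has_vector_derivative sm gsm)
    qed (use per gper close in auto)
    have low: "7 * c / 8 * \<bar>sin ((t - s) / 2)\<bar> \<le> norm (f t - f s)" for s t
    proof -
      have "norm (g t - g s) \<le> norm (f t - f s) + norm ((f t - g t) - (f s - g s))"
        using norm_triangle_ineq4[of "f t - f s" "(f t - g t) - (f s - g s)"]
        by (simp add: algebra_simps)
      then show ?thesis using c(2)[of t s] diff[of t s] by (simp add: field_simps)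
    qed
    have "smooth_embedding f"
      using per sm c(1) low by (intro smooth_embeddingI_bilipschitz[of f "7 * c / 8"]) auto
    moreover have "ambient_isotopic (range f) (range g)"
    proof (rule ambient_isotopic_perturbation)
      show "norm ((g s - f s) - (g t - f t)) \<le> 1 / 7 * norm (f s - f t)" for s t
      proof -
        have "norm ((g s - f s) - (g t - f t)) = norm ((f t - g t) - (f s - g s))"
          by (simp add: algebra_simps)
        also have "\<dots> \<le> 1 / 7 * (7 * c / 8 * \<bar>sin ((t - s) / 2)\<bar>)"
          using diff[of t s] by simp
        also have "\<dots> \<le> 1 / 7 * norm (f s - f t)"
          using low[of t s] by (simp add: norm_minus_commute)
        finally show ?thesis .
      qed
    qed auto
    ultimately show "parametrisation_of f (range g)"
      by (simp add: parametrisation_of_def)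
  qed
qed

section \<open>Derivatives of curves by coordinates\<close>

lemma has_vector_derivative_componentwise:
  fixes f :: "real \<Rightarrow> real ^ 'n"
  assumes "\<And>i. ((\<lambda>t. f t $ i) has_real_derivative D $ i) (at t)"
  shows "(f has_vector_derivative D) (at t)"
  unfolding has_vector_derivative_def
proof (subst has_derivative_componentwise_within, intro ballI)
  fix b :: "real ^ 'n" assume "b \<in> Basis"
  then obtain i where b: "b = axis i 1" by (auto simp: Basis_vec_def)
  have "((\<lambda>t. f t $ i) has_derivative (\<lambda>h. h * D $ i)) (at t)"
    using assms[of i] by (simp add: has_field_derivative_def mult_commute_abs)
  then show "((\<lambda>t. f t \<bullet> b) has_derivative (\<lambda>h. (h *\<^sub>R D) \<bullet> b)) (at t)"
    by (simp add: b inner_axis)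
qed

lemma has_vector_derivative_component:
  assumes "(f has_vector_derivative D) (at t)"
  shows "((\<lambda>t. f t $ i) has_real_derivative D $ i) (at t)"
  using bounded_linear.has_vector_derivative[OF bounded_linear_vec_nth assms]
  by (simp add: has_real_derivative_iff_has_vector_derivative)

text \<open>A sequence of curves each of which is the derivative of its predecessor identifies the iterated
derivatives, without any computation with \<^const>\<open>nth_derivative\<close>.\<close>

lemma derivative_family:
  assumes der: "\<And>n t. (F n has_vector_derivative F (Suc n) t) (at t)"
  shows nth_derivative_family: "nth_derivative n (F m) = F (m + n)"
    and smooth_family: "smooth (F m)"
proof -
  show eq: "nth_derivative n (F m) = F (m + n)" for n
  proof (induction n)
    case (Suc n)
    have "nth_derivative (Suc n) (F m) = (\<lambda>t. vector_derivative (nth_derivative n (F m)) (at t))"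
      by (simp add: nth_derivative_def)
    also have "\<dots> = F (m + Suc n)"
      using der vector_derivative_at by (force simp: Suc)
    finally show ?case .
  qed (simp add: nth_derivative_def)
  show "smooth (F m)"
    unfolding smooth_def eq using der by (auto intro: differentiableI_vector)
qed

lemma smooth_embedding_of_scaled:
  fixes c :: "3 \<Rightarrow> real"
  assumes per: "\<And>t. f (t + 2 * pi) = f t" and sm: "smooth f"
    and emb: "smooth_embedding (\<lambda>t. \<chi> i. c i * f t $ i)"
  shows "smooth_embedding f"
  unfolding smooth_embedding_def
proof (intro conjI allI)
  show "inj_on f {0..<2 * pi}"
  proof (rule inj_onI)
    fix s t assume st: "s \<in> {0..<2 * pi}" "t \<in> {0..<2 * pi}" and eq: "f s = f t"
    have "inj_on (\<lambda>t. \<chi> i. c i * f t $ i) {0..<2 * pi}"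
      using emb unfolding smooth_embedding_def by blast
    from inj_onD[OF this _ st] show "s = t"
      by (simp add: eq)
  qed
  show "vector_derivative f (at t) \<noteq> 0" for t
  proof
    assume "vector_derivative f (at t) = 0"
    then have "(f has_vector_derivative 0) (at t)"
      using smooth_has_vector_derivative[OF sm, of t] by simp
    from DERIV_cmult[OF has_vector_derivative_component[OF this]]
    have "((\<lambda>t. c i * f t $ i) has_real_derivative c i * 0 $ i) (at t)" for i .
    then have "((\<lambda>t. \<chi> i. c i * f t $ i) has_vector_derivative 0) (at t)"
      by (intro has_vector_derivative_componentwise) simp
    then have "vector_derivative (\<lambda>t. \<chi> i. c i * f t $ i) (at t) = 0"
      by (rule vector_derivative_at)
    then show False
      using emb unfolding smooth_embedding_def by blast
  qed
qed (use per sm in auto)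

section \<open>Trigonometric polynomials\<close>

text \<open>Trigonometric polynomials of degree below \<open>q\<close>. Amplitude and phase replace the pair of a sine and a
cosine: derivatives, antiderivatives and products of harmonics are then again (sums of) harmonics. Negative
frequencies are admitted so that the product formula needs no case distinction.\<close>

inductive trig_poly :: "nat \<Rightarrow> (real \<Rightarrow> real) \<Rightarrow> bool" where
  harmonic: "\<bar>k\<bar> < int q \<Longrightarrow> trig_poly q (\<lambda>t. a * cos (of_int k * t + \<phi>))"
| add: "trig_poly q f \<Longrightarrow> trig_poly q g \<Longrightarrow> trig_poly q (\<lambda>t. f t + g t)"

lemma trig_poly_harmonic_nat: "k < q \<Longrightarrow> trig_poly q (\<lambda>t. a * cos (real k * t + \<phi>))"
  using harmonic[of "int k" q a \<phi>] by simp

lemma trig_poly_mono: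
  assumes "trig_poly q f" and "q \<le> r"
  shows "trig_poly r f"
  using assms by induction (auto intro: trig_poly.intros)

lemma trig_poly_const: "q > 0 \<Longrightarrow> trig_poly q (\<lambda>_. c)"
  using harmonic[of 0 q c 0] by simp

lemma trig_poly_mult:
  assumes f: "trig_poly q f" and g: "trig_poly r g"
  shows "trig_poly (q + r) (\<lambda>t. f t * g t)"
  using f
proof induction
  case (harmonic k q a \<phi>)
  from g show ?case
  proof induction
    case (harmonic l r b \<psi>)
    have "trig_poly (q + r) (\<lambda>t. a * b / 2 * cos (of_int (k - l) * t + (\<phi> - \<psi>))
        + a * b / 2 * cos (of_int (k + l) * t + (\<phi> + \<psi>)))"
      using harmonic \<open>\<bar>k\<bar> < int q\<close> by (intro trig_poly.intros) auto
    also have "(\<lambda>t. a * b / 2 * cos (of_int (k - l) * t + (\<phi> - \<psi>))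
        + a * b / 2 * cos (of_int (k + l) * t + (\<phi> + \<psi>)))
      = (\<lambda>t. a * cos (of_int k * t + \<phi>) * (b * cos (of_int l * t + \<psi>)))"
    proof
      fix t
      have "of_int (k - l) * t + (\<phi> - \<psi>) = (of_int k * t + \<phi>) - (of_int l * t + \<psi>)"
        "of_int (k + l) * t + (\<phi> + \<psi>) = (of_int k * t + \<phi>) + (of_int l * t + \<psi>)"
        by (simp_all add: algebra_simps)
      then show "a * b / 2 * cos (of_int (k - l) * t + (\<phi> - \<psi>))
        + a * b / 2 * cos (of_int (k + l) * t + (\<phi> + \<psi>))
        = a * cos (of_int k * t + \<phi>) * (b * cos (of_int l * t + \<psi>))"
        by (simp only: cos_add[of "of_int k * t + \<phi>"] cos_diff[of "of_int k * t + \<phi>"])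
          (simp add: algebra_simps)
    qed
    finally show ?case .
  next
    case (add r g1 g2)
    then show ?case using trig_poly.add by (fastforce simp: algebra_simps)
  qed
next
  case (add q f1 f2)
  then show ?case using trig_poly.add by (fastforce simp: algebra_simps)
qed

lemma cos_harmonic_periodic: "cos (of_int k * (t + 2 * pi) + \<phi>) = cos (of_int k * t + \<phi>)"
proof -
  have "of_int k * (t + 2 * pi) + \<phi> = (of_int k * t + \<phi>) + (2 * pi) * of_int k"
    by (simp add: algebra_simps)
  then show ?thesis by (simp only: cos_add cos_int_2pin sin_int_2pin) simp
qed

lemma trig_poly_periodic: "trig_poly q f \<Longrightarrow> f (t + 2 * pi) = f t"
  by (induction rule: trig_poly.induct) (simp_all only: cos_harmonic_periodic)

text \<open>The constant \<open>a\<close> is the mean value of \<open>f\<close>; it has to be removed for a periodic antiderivative to exist.\<close>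

lemma trig_poly_antiderivative:
  assumes "trig_poly q f"
  shows "\<exists>a F. trig_poly q F \<and> (\<forall>t. (F has_real_derivative f t - a) (at t))"
  using assms
proof induction
  case (harmonic k q a \<phi>)
  show ?case
  proof (cases "k = 0")
    case True
    then have "trig_poly q (\<lambda>_. 0)" using harmonic by (intro trig_poly_const) auto
    with True show ?thesis by (intro exI[of _ "a * cos \<phi>"] exI[of _ "\<lambda>_. 0"]) auto
  next
    case False
    have "((\<lambda>t. a / of_int k * cos (of_int k * t + (\<phi> - pi / 2))) has_real_derivative
        a * cos (of_int k * t + \<phi>)) (at t)" for t
    proof -
      have "sin (of_int k * t + (\<phi> - pi / 2)) = - cos (of_int k * t + \<phi>)"
        using sin_diff[of "of_int k * t + \<phi>" "pi / 2"] by (simp add: add_diff_eq)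
      then show ?thesis using False by (auto intro!: derivative_eq_intros)
    qed
    moreover have "trig_poly q (\<lambda>t. a / of_int k * cos (of_int k * t + (\<phi> - pi / 2)))"
      using harmonic by (rule trig_poly.harmonic)
    ultimately show ?thesis
      by (intro exI[of _ 0] exI[of _ "\<lambda>t. a / of_int k * cos (of_int k * t + (\<phi> - pi / 2))"]) simp
  qed
next
  case (add q f g)
  then obtain a F b G where "trig_poly q F" "trig_poly q G"
    "\<And>t. (F has_real_derivative f t - a) (at t)" "\<And>t. (G has_real_derivative g t - b) (at t)"
    by blast
  then show ?case
    by (intro exI[of _ "a + b"] exI[of _ "\<lambda>t. F t + G t"])
      (auto intro!: trig_poly.add derivative_eq_intros)
qed

text \<open>All derivatives at once, with the growth rate \<open>(q - 1)\<^sup>n\<close> set by the highest possible frequency.\<close>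

lemma trig_poly_derivatives:
  assumes "trig_poly q f"
  shows "\<exists>D C. D 0 = f \<and> (\<forall>n t. (D n has_real_derivative D (Suc n) t) (at t)) \<and>
           (\<forall>n t. D n (t + 2 * pi) = D n t) \<and> (\<forall>n t. \<bar>D n t\<bar> \<le> C * (real q - 1) ^ n)"
  using assms
proof induction
  case (harmonic k q a \<phi>)
  let ?D = "\<lambda>n t. a * of_int k ^ n * cos (of_int k * t + (\<phi> + real n * pi / 2))"
  have "(?D n has_real_derivative ?D (Suc n) t) (at t)" for n t
  proof -
    have "cos (of_int k * t + (\<phi> + real (Suc n) * pi / 2))
        = - sin (of_int k * t + (\<phi> + real n * pi / 2))"
      using cos_add[of "of_int k * t + (\<phi> + real n * pi / 2)" "pi / 2"]
      by (simp add: algebra_simps add_divide_distrib)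
    then show ?thesis by (auto intro!: derivative_eq_intros)
  qed
  moreover have "\<bar>?D n t\<bar> \<le> \<bar>a\<bar> * (real q - 1) ^ n" for n t
  proof -
    have "\<bar>of_int k\<bar> \<le> real q - 1" using harmonic by linarith
    then have "\<bar>of_int k :: real\<bar> ^ n \<le> (real q - 1) ^ n" by (intro power_mono) auto
    then have "\<bar>a\<bar> * \<bar>of_int k\<bar> ^ n * \<bar>cos (of_int k * t + (\<phi> + real n * pi / 2))\<bar>
        \<le> \<bar>a\<bar> * (real q - 1) ^ n * 1"
      by (intro mult_mono mult_nonneg_nonneg) (use harmonic in auto)
    then show ?thesis by (simp add: abs_mult power_abs)
  qed
  ultimately show ?case
    by (intro exI[of _ ?D] exI[of _ "\<bar>a\<bar>"]) (auto simp: cos_harmonic_periodic)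
next
  case (add q f g)
  then obtain D C E B where D: "D 0 = f" "\<And>n t. (D n has_real_derivative D (Suc n) t) (at t)"
      "\<And>n t. D n (t + 2 * pi) = D n t" "\<And>n t. \<bar>D n t\<bar> \<le> C * (real q - 1) ^ n"
    and E: "E 0 = g" "\<And>n t. (E n has_real_derivative E (Suc n) t) (at t)"
      "\<And>n t. E n (t + 2 * pi) = E n t" "\<And>n t. \<bar>E n t\<bar> \<le> B * (real q - 1) ^ n"
    by metis
  show ?case
  proof (intro exI[of _ "\<lambda>n t. D n t + E n t"] exI[of _ "C + B"] conjI allI)
    show "\<bar>D n t + E n t\<bar> \<le> (C + B) * (real q - 1) ^ n" for n t
      using D(4)[of n t] E(4)[of n t] by (simp add: distrib_right)
  qed (use D E in \<open>auto intro!: derivative_eq_intros\<close>)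
qed

lemma periodic_eq_if_cis_eq:
  fixes h :: "real \<Rightarrow> 'a"
  assumes per: "\<And>t. h (t + 2 * pi) = h t" and eq: "cis s = cis t"
  shows "h s = h t"
proof -
  have "sin s = sin t \<and> cos s = cos t" using eq by (simp add: complex_eq_iff)
  then obtain n :: int where "s = t + 2 * pi * of_int n"
    by (auto simp: sin_cos_eq_iff)
  then have "s = t + of_int n * (2 * pi)" by simp
  then show ?thesis using periodic_int[of h "2*pi" t n, OF per] by simp
qed

text \<open>The jump of \<^const>\<open>Arg\<close> across the negative real axis is a full period and thus invisible to \<open>h\<close>. Near that axis the
branch \<open>Arg (- w) + \<pi>\<close> takes over.\<close>

lemma continuous_on_circle_Arg:
  fixes h :: "real \<Rightarrow> 'a::topological_space"
  assumes cont: "continuous_on UNIV h" and per: "\<And>t. h (t + 2 * pi) = h t"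
  shows "continuous_on (sphere 0 1) (\<lambda>z. h (Arg z))"
proof (intro continuous_at_imp_continuous_on ballI)
  fix z :: complex assume z: "z \<in> sphere 0 1"
  have h: "isCont h t" for t
    using cont by (simp add: continuous_on_eq_continuous_at)
  show "isCont (\<lambda>z. h (Arg z)) z"
  proof (cases "z \<in> \<real>\<^sub>\<le>\<^sub>0")
    case False
    then show ?thesis
      using isCont_o2[OF continuous_at_Arg h] by blast
  next
    case True
    have "- z \<notin> \<real>\<^sub>\<le>\<^sub>0"
    proof
      assume "- z \<in> \<real>\<^sub>\<le>\<^sub>0"
      then have "z = 0" using True by (simp add: complex_nonpos_Reals_iff complex_eq_iff)
      then show False using z by simp
    qed
    then have "isCont (\<lambda>w. Arg (- w) + pi) z"
      by (intro continuous_intros isCont_o2[OF _ continuous_at_Arg, of _ uminus])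
    then have "isCont (\<lambda>w. h (Arg (- w) + pi)) z"
      using isCont_o2[OF _ h] by blast
    moreover have "\<forall>\<^sub>F w in nhds z. h (Arg w) = h (Arg (- w) + pi)"
    proof -
      have "h (Arg w) = h (Arg (- w) + pi)" if "w \<noteq> 0" for w
      proof (rule periodic_eq_if_cis_eq[of h])
        show "h (t + 2 * pi) = h t" for t by (rule per)
        have "cis (Arg w) = sgn w" "cis (Arg (- w)) = sgn (- w)"
          using that by (auto simp: cis_Arg)
        then show "cis (Arg w) = cis (Arg (- w) + pi)"
          by (simp add: sgn_minus flip: cis_mult)
      qed
      moreover have "\<forall>\<^sub>F w in nhds z. w \<noteq> 0"
        using z by (intro t1_space_nhds) auto
      ultimately show ?thesis by (auto elim: eventually_mono)
    qed
    ultimately show ?thesis using isCont_cong by fast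
  qed
qed

text \<open>The theorem of Stone and Weierstrass on the unit circle; the coordinates of the plane, which restrict to cosine
and sine, separate its points.\<close>

lemma trig_poly_dense:
  fixes h :: "real \<Rightarrow> real"
  assumes cont: "continuous_on UNIV h" and per: "\<And>t. h (t + 2 * pi) = h t" and e: "e > 0"
  obtains q p where "trig_poly q p" and "\<And>t. \<bar>h t - p t\<bar> < e"
proof -
  let ?S = "sphere 0 1 :: complex set"
  define P where "P F \<longleftrightarrow> continuous_on ?S F \<and> (\<exists>q p. trig_poly q p \<and> (\<forall>t. F (cis t) = p t))"
    for F :: "complex \<Rightarrow> real"
  have "\<exists>G. P G \<and> (\<forall>z\<in>?S. \<bar>h (Arg z) - G z\<bar> < e)"
  proof (rule Stone_Weierstrass_HOL[of ?S P "\<lambda>z. h (Arg z)" e])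
    show "P (\<lambda>z. c)" for c
      unfolding P_def using trig_poly_const[of 1 c] by auto
    show "P (\<lambda>z. F z + G z)" if "P F \<and> P G" for F G
    proof -
      obtain q p where p: "trig_poly q p" "\<And>t. F (cis t) = p t"
        using \<open>P F \<and> P G\<close> unfolding P_def by blast
      obtain q' p' where p': "trig_poly q' p'" "\<And>t. G (cis t) = p' t"
        using \<open>P F \<and> P G\<close> unfolding P_def by blast
      have "trig_poly (max q q') (\<lambda>t. p t + p' t)"
        using p(1) p'(1) by (intro trig_poly.add) (auto elim: trig_poly_mono)
      then show ?thesis
        using that p(2) p'(2) unfolding P_def by (auto intro!: continuous_intros)
    qed
    show "P (\<lambda>z. F z * G z)" if "P F \<and> P G" for F G
    proof -
      obtain q p where p: "trig_poly q p" "\<And>t. F (cis t) = p t"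
        using \<open>P F \<and> P G\<close> unfolding P_def by blast
      obtain q' p' where p': "trig_poly q' p'" "\<And>t. G (cis t) = p' t"
        using \<open>P F \<and> P G\<close> unfolding P_def by blast
      show ?thesis
        using that p(2) p'(2) trig_poly_mult[OF p(1) p'(1)]
        unfolding P_def by (auto intro!: continuous_intros)
    qed
    show "\<exists>F. P F \<and> F x \<noteq> F y" if "x \<in> ?S \<and> y \<in> ?S \<and> x \<noteq> y" for x y
    proof -
      have "P Re"
        unfolding P_def using harmonic[of 1 2 1 0] by (auto intro!: continuous_intros)
      moreover have "P Im"
        unfolding P_def using harmonic[of 1 2 1 "- pi / 2"]
        by (auto intro!: continuous_intros simp: cos_diff)
      ultimately show ?thesis using that complex_eq_iff by metis
    qed
    show "continuous_on ?S (\<lambda>z. h (Arg z))"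
      using cont per by (rule continuous_on_circle_Arg)
  qed (use e P_def in auto)
  then obtain G q p where p: "trig_poly q p" "\<And>t. G (cis t) = p t"
    and G: "\<And>z. z \<in> ?S \<Longrightarrow> \<bar>h (Arg z) - G z\<bar> < e"
    unfolding P_def by blast
  show thesis
  proof
    show "trig_poly q p" by fact
    show "\<bar>h t - p t\<bar> < e" for t
    proof -
      have "h (Arg (cis t)) = h t"
        using per by (rule periodic_eq_if_cis_eq) (simp add: cis_Arg)
      then show ?thesis using G[of "cis t"] p(2) by simp
    qed
  qed
qed

text \<open>Approximate \<open>h'\<close> uniformly and integrate. The mean value \<open>a\<close> of the approximation is small since \<open>h'\<close>, being
the derivative of a periodic function, has mean \<open>0\<close>; the mean value inequality over one period shows this
without integrals.\<close>

lemma trig_poly_dense_C1: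
  fixes h :: "real \<Rightarrow> real"
  assumes der: "\<And>t. (h has_real_derivative h' t) (at t)" and cont: "continuous_on UNIV h'"
    and per: "\<And>t. h (t + 2 * pi) = h t" and e: "e > 0"
  obtains q p p' where "trig_poly q p" and "\<And>t. (p has_real_derivative p' t) (at t)"
    and "\<And>t. \<bar>p' t - h' t\<bar> \<le> e"
proof -
  have per': "h' (t + 2 * pi) = h' t" for t
    using periodic_vector_derivative[of h "2 * pi" h'] per der
    by (simp add: has_real_derivative_iff_has_vector_derivative)
  obtain q p where p: "trig_poly q p" "\<And>t. \<bar>h' t - p t\<bar> < e / 2"
    using trig_poly_dense[OF cont per', of "e / 2"] e by auto
  obtain a F where F: "trig_poly q F" "\<And>t. (F has_real_derivative p t - a) (at t)"
    using trig_poly_antiderivative[OF p(1)] by blast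
  have "norm ((F (2 * pi) + a * (2 * pi) - h (2 * pi)) - (F 0 + a * 0 - h 0)) \<le> e / 2 * norm (2 * pi - 0)"
  proof (rule field_differentiable_bound[where S = UNIV and f' = "\<lambda>t. p t - h' t" and
        f = "\<lambda>t. F t + a * t - h t"])
    show "((\<lambda>t. F t + a * t - h t) has_real_derivative p t - h' t) (at t within UNIV)" for t
      using F(2) der by (auto intro!: derivative_eq_intros)
    show "norm (p t - h' t) \<le> e / 2" for t
      using p(2)[of t] by (simp add: abs_minus_commute)
  qed auto
  moreover have "F (2 * pi) = F 0" "h (2 * pi) = h 0"
    using trig_poly_periodic[OF F(1), of 0] per[of 0] by auto
  ultimately have "\<bar>a\<bar> * (2 * pi) \<le> e / 2 * (2 * pi)"
    by (simp add: abs_mult)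
  then have a: "\<bar>a\<bar> \<le> e / 2"
    using pi_gt_zero by (simp only: mult_le_cancel_right)
  show thesis
  proof
    show "trig_poly q F" by fact
    show "(F has_real_derivative p t - a) (at t)" for t by fact
    show "\<bar>p t - a - h' t\<bar> \<le> e" for t
      using p(2)[of t] a by linarith
  qed
qed

lemma smooth_trig_poly_curve:
  fixes f :: "real \<Rightarrow> real^'n"
  assumes "\<And>i. trig_poly (q i) (\<lambda>t. f t $ i)"
  shows "smooth f"
proof -
  have "\<exists>D. D 0 = (\<lambda>t. f t $ i) \<and> (\<forall>n t. (D n has_real_derivative D (Suc n) t) (at t))" for i
    using trig_poly_derivatives[OF assms[of i]] by blast
  then obtain D where D: "\<And>i. D i 0 = (\<lambda>t. f t $ i)"
    "\<And>i n t. (D i n has_real_derivative D i (Suc n) t) (at t)"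
    by metis
  have "smooth (\<lambda>t. \<chi> i. D i 0 t)"
  proof (rule smooth_family[where F = "\<lambda>n t. \<chi> i. D i n t" and m = 0])
    show "((\<lambda>t. \<chi> i. D i n t) has_vector_derivative (\<chi> i. D i (Suc n) t)) (at t)" for n t
      by (rule has_vector_derivative_componentwise) (simp add: D)
  qed
  then show ?thesis by (simp add: D)
qed

section \<open>Lissajous curves that are unknotted\<close>

text \<open>The functions \<open>T\<close> and \<open>U\<close> are the Chebyshev polynomials of the first and second kind (for \<open>U\<close>, of index
\<open>n - 1\<close>). Only their continuity enters the shears below.\<close>

lemma multiple_angle:
  obtains T U :: "real \<Rightarrow> real" where "continuous_on UNIV T" and "continuous_on UNIV U"
    and "\<And>t. cos (real n * t) = T (cos t)" and "\<And>t. sin (real n * t) = sin t * U (cos t)"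
proof -
  have "\<exists>T U :: real \<Rightarrow> real. continuous_on UNIV T \<and> continuous_on UNIV U \<and>
      (\<forall>t. cos (real n * t) = T (cos t)) \<and> (\<forall>t. sin (real n * t) = sin t * U (cos t))"
  proof (induction n)
    case 0
    show ?case by (intro exI[of _ "\<lambda>_. 1"] exI[of _ "\<lambda>_. 0"]) auto
  next
    case (Suc n)
    then obtain T U :: "real \<Rightarrow> real" where TU: "continuous_on UNIV T" "continuous_on UNIV U"
      "\<And>t. cos (real n * t) = T (cos t)" "\<And>t. sin (real n * t) = sin t * U (cos t)"
      by blast
    have Suc_angle: "real (Suc n) * t = real n * t + t" for t by (simp add: algebra_simps)
    have "cos (real (Suc n) * t) = T (cos t) * cos t - (1 - (cos t)\<^sup>2) * U (cos t)" for t
      unfolding Suc_angle cos_add TU(3,4) sin_squared_eq[symmetric] by (simp add: power2_eq_square)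
    moreover have "sin (real (Suc n) * t) = sin t * (U (cos t) * cos t + T (cos t))" for t
      unfolding Suc_angle sin_add TU(3,4) by (simp add: algebra_simps)
    ultimately show ?case
      using TU(1,2)
      by (intro exI[of _ "\<lambda>x. T x * x - (1 - x\<^sup>2) * U x"] exI[of _ "\<lambda>x. U x * x + T x"])
        (auto intro!: continuous_intros)
  qed
  then show ?thesis using that by blast
qed

lemma sin_odd_multiple_angle:
  "sin ((2 * real q + 1) * t) = 2 * sin (real q * t) * cos ((real q + 1) * t) + sin t"
proof -
  have "(2 * real q + 1) * t = (real q + 1) * t + real q * t" "t = (real q + 1) * t - real q * t"
    by (simp_all add: algebra_simps)
  then have "sin ((2 * real q + 1) * t) - sin t
      = sin ((real q + 1) * t + real q * t) - sin ((real q + 1) * t - real q * t)"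
    by metis
  then show ?thesis unfolding sin_add[of "(real q + 1) * t"] sin_diff[of "(real q + 1) * t"] by simp
qed

lemma ambient_isotopic_shear_curve:
  fixes L M :: "'a \<Rightarrow> real^3"
  assumes "continuous_on UNIV h" and "\<And>x c. h (x + c *\<^sub>R axis i 1) = h x"
    and "\<And>t. M t = L t + h (L t) *\<^sub>R axis i 1"
    and "ambient_isotopic (range M) B"
  shows "ambient_isotopic (range L) B"
proof -
  have "range M = (\<lambda>x. x + h x *\<^sub>R axis i 1) ` range L"
    by (simp add: assms(3) image_image)
  then show ?thesis
    using ambient_isotopic_trans[OF ambient_isotopic_shear[of h "axis i 1" "range L"]] assms by metis
qed

text \<open>Shears of a single coordinate by a function of the two others, in a form suited to rewriting a curve step by step.\<close>

lemma ambient_isotopic_shear_1: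
  fixes h :: "real \<Rightarrow> real \<Rightarrow> real"
  assumes "continuous_on UNIV (\<lambda>v :: real^3. h (v $ 2) (v $ 3))"
    and "\<And>t. w t = x t + h (y t) (z t)"
    and "ambient_isotopic (range (\<lambda>t. vector [w t, y t, z t])) B"
  shows "ambient_isotopic (range (\<lambda>t. vector [x t, y t, z t])) B"
proof (rule ambient_isotopic_shear_curve[where M = "\<lambda>t. vector [w t, y t, z t]"
      and h = "\<lambda>v. h (v $ 2) (v $ 3)" and i = 1])
  show "continuous_on UNIV (\<lambda>v :: real^3. h (v $ 2) (v $ 3))" by fact
  show "h ((v + c *\<^sub>R axis 1 1) $ 2) ((v + c *\<^sub>R axis 1 1) $ 3) = h (v $ 2) (v $ 3)" for v :: "real^3" and c
    by (simp add: axis_def)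
  show "(vector [w t, y t, z t] :: real^3) = vector [x t, y t, z t] +
      h ((vector [x t, y t, z t] :: real^3) $ 2) ((vector [x t, y t, z t] :: real^3) $ 3) *\<^sub>R axis 1 1" for t
    by (simp add: axis_def vec_eq_iff forall_3 assms(2))
qed fact

lemma ambient_isotopic_shear_2:
  fixes h :: "real \<Rightarrow> real \<Rightarrow> real"
  assumes "continuous_on UNIV (\<lambda>v :: real^3. h (v $ 1) (v $ 3))"
    and "\<And>t. w t = y t + h (x t) (z t)"
    and "ambient_isotopic (range (\<lambda>t. vector [x t, w t, z t])) B"
  shows "ambient_isotopic (range (\<lambda>t. vector [x t, y t, z t])) B"
proof (rule ambient_isotopic_shear_curve[where M = "\<lambda>t. vector [x t, w t, z t]"
      and h = "\<lambda>v. h (v $ 1) (v $ 3)" and i = 2])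
  show "continuous_on UNIV (\<lambda>v :: real^3. h (v $ 1) (v $ 3))" by fact
  show "h ((v + c *\<^sub>R axis 2 1) $ 1) ((v + c *\<^sub>R axis 2 1) $ 3) = h (v $ 1) (v $ 3)" for v :: "real^3" and c
    by (simp add: axis_def)
  show "(vector [x t, w t, z t] :: real^3) = vector [x t, y t, z t] +
      h ((vector [x t, y t, z t] :: real^3) $ 1) ((vector [x t, y t, z t] :: real^3) $ 3) *\<^sub>R axis 2 1" for t
    by (simp add: axis_def vec_eq_iff forall_3 assms(2))
qed fact

lemma ambient_isotopic_shear_3:
  fixes h :: "real \<Rightarrow> real \<Rightarrow> real"
  assumes "continuous_on UNIV (\<lambda>v :: real^3. h (v $ 1) (v $ 2))"
    and "\<And>t. w t = z t + h (x t) (y t)"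
    and "ambient_isotopic (range (\<lambda>t. vector [x t, y t, w t])) B"
  shows "ambient_isotopic (range (\<lambda>t. vector [x t, y t, z t])) B"
proof (rule ambient_isotopic_shear_curve[where M = "\<lambda>t. vector [x t, y t, w t]"
      and h = "\<lambda>v. h (v $ 1) (v $ 2)" and i = 3])
  show "continuous_on UNIV (\<lambda>v :: real^3. h (v $ 1) (v $ 2))" by fact
  show "h ((v + c *\<^sub>R axis 3 1) $ 1) ((v + c *\<^sub>R axis 3 1) $ 2) = h (v $ 1) (v $ 2)" for v :: "real^3" and c
    by (simp add: axis_def)
  show "(vector [x t, y t, w t] :: real^3) = vector [x t, y t, z t] +
      h ((vector [x t, y t, z t] :: real^3) $ 1) ((vector [x t, y t, z t] :: real^3) $ 2) *\<^sub>R axis 3 1" for t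
    by (simp add: axis_def vec_eq_iff forall_3 assms(2))
qed fact

lemma ellipse_unknot:
  assumes "\<bar>\<sigma>\<bar> = 1" and "\<kappa> \<noteq> 0"
  shows "ambient_isotopic (range (\<lambda>t. vector [\<sigma> * cos t, \<kappa> * sin t, 0])) unknot"
proof -
  define c :: "real^3" where "c = vector [1, 1 / \<bar>\<kappa>\<bar>, 1]"
  have c: "c $ i > 0" for i
    using assms(2) exhaust_3[of i] by (auto simp: c_def)
  define \<tau> where "\<tau> = \<kappa> / \<bar>\<kappa>\<bar>"
  have \<tau>: "\<tau> = 1 \<or> \<tau> = -1" and \<sigma>: "\<sigma> = 1 \<or> \<sigma> = -1"
    using assms by (auto simp: \<tau>_def abs_if split: if_splits)
  have "(\<lambda>x. \<chi> i. c $ i * x $ i) ` range (\<lambda>t. vector [\<sigma> * cos t, \<kappa> * sin t, 0] :: real^3)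
      = range (\<lambda>t. vector [\<sigma> * cos t, \<tau> * sin t, 0])"
    unfolding image_image
    by (intro image_cong refl) (simp add: c_def \<tau>_def vec_eq_iff forall_3)
  also have "\<dots> = unknot"
  proof -
    \<comment> \<open>All four choices of signs merely reparametrise the circle.\<close>
    define r where "r t = (if \<sigma> = 1 then \<tau> * t else pi - \<tau> * t)" for t :: real
    have r: "\<sigma> * cos t = cos (r t)" "\<tau> * sin t = sin (r t)" for t
      using \<sigma> \<tau> unfolding r_def by (elim disjE; simp)+
    have "surj r"
    proof (rule surjI)
      show "r (if \<sigma> = 1 then \<tau> * t else \<tau> * (pi - t)) = t" for t
        using \<tau> by (auto simp: r_def)
    qed
    then have "unknot = (\<lambda>t. vector [cos t, sin t, 0]) ` range r"
      by (simp add: unknot_def)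
    then show ?thesis by (simp add: r image_image)
  qed
  finally show ?thesis
    using ambient_isotopic_scale[of c "range (\<lambda>t. vector [\<sigma> * cos t, \<kappa> * sin t, 0])"] c by simp
qed

definition lissajous :: "nat \<Rightarrow> real \<Rightarrow> real \<Rightarrow> real \<Rightarrow> real^3" where
  "lissajous q \<sigma> p t = vector [\<sigma> * cos ((4 * real q + 1) * t + 4 * p),
     cos ((2 * real q + 1) * t + 2 * p), cos (real q * t + p)]"

text \<open>The sum and difference formulas for the angles \<open>a = (2q + 1)t + 2p\<close> and \<open>2b\<close>, where \<open>b = qt + p\<close>: here
\<open>a + 2b = (4q + 1)t + 4p\<close> and \<open>a - 2b = t\<close>.\<close>

lemma lissajous_cos_identity:
  "cos ((4 * real q + 1) * t + 4 * p)
     = 2 * cos ((2 * real q + 1) * t + 2 * p) * (2 * (cos (real q * t + p))\<^sup>2 - 1) - cos t"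
proof -
  define a b where "a = (2 * real q + 1) * t + 2 * p" and "b = real q * t + p"
  have sum: "a + 2 * b = (4 * real q + 1) * t + 4 * p" and diff: "a - 2 * b = t"
    by (simp_all add: a_def b_def algebra_simps)
  have "cos (a + 2 * b) + cos (a - 2 * b) = 2 * cos a * (2 * (cos b)\<^sup>2 - 1)"
    unfolding cos_add[of a] cos_diff[of a] cos_double_cos[of b] by simp
  then have "cos (a + 2 * b) = 2 * cos a * (2 * (cos b)\<^sup>2 - 1) - cos (a - 2 * b)"
    by linarith
  from this[unfolded sum diff] show ?thesis
    unfolding a_def b_def .
qed

text \<open>Five shears lead to an ellipse. The first replaces the first coordinate by \<open>-\<sigma> cos t\<close>. Functions of
\<open>cos t\<close> are then functions of the first coordinate, so the parts \<open>cos 2p cos ((2q + 1)t)\<close> and \<open>cos p cos (qt)\<close>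
of the other coordinates can be removed, which leaves multiples of \<open>sin ((2q + 1)t)\<close> and \<open>sin (qt)\<close>. Finally
\<open>sin ((2q + 1)t)\<close> differs from \<open>sin t\<close> by a multiple of \<open>sin (qt)\<close> with a factor depending on \<open>cos t\<close>, and
\<open>sin (qt)\<close> is itself such a multiple of \<open>sin t\<close>. The last two shears divide by \<open>sin p\<close> and \<open>sin 2p\<close>.\<close>

lemma lissajous_unknot:
  assumes \<sigma>: "\<bar>\<sigma>\<bar> = 1" and p: "sin (2 * p) \<noteq> 0"
  shows "ambient_isotopic (range (lissajous q \<sigma> p)) unknot"
proof -
  have p1: "sin p \<noteq> 0" using p by (auto simp: sin_double)
  have \<sigma>2: "\<sigma> * \<sigma> = 1" using \<sigma> by (metis abs_mult_self_eq mult_1)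
  obtain T U where TU: "continuous_on UNIV T" "continuous_on UNIV U"
    "\<And>t. cos (real q * t) = T (cos t)" "\<And>t. sin (real q * t) = sin t * U (cos t)"
    by (rule multiple_angle[of q]) (rule that)
  obtain T1 where T1: "continuous_on UNIV T1" "\<And>t. cos (real (q + 1) * t) = T1 (cos t)"
    by (rule multiple_angle[of "q + 1"]) (rule that)
  obtain T2 where T2: "continuous_on UNIV T2" "\<And>t. cos (real (2 * q + 1) * t) = T2 (cos t)"
    by (rule multiple_angle[of "2 * q + 1"]) (rule that)
  have T1': "cos ((real q + 1) * t) = T1 (cos t)" and T2': "cos ((2 * real q + 1) * t) = T2 (cos t)" for t
    using T1(2)[of t] T2(2)[of t] by (simp_all add: add.commute)
  have comp: "continuous_on UNIV (\<lambda>v :: real^3. H (- \<sigma> * v $ 1))" if "continuous_on UNIV H" for H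
    by (intro continuous_on_compose2[OF that] continuous_intros) auto
  have cos_eq: "- \<sigma> * (- \<sigma> * cos t) = cos t" for t
    using \<sigma>2 by (simp flip: mult.assoc)
  let ?s = "sin (2 * p)"
  show ?thesis
    unfolding lissajous_def
  proof (rule ambient_isotopic_shear_1[where h = "\<lambda>y z. - 2 * \<sigma> * y * (2 * z\<^sup>2 - 1)" and w = "\<lambda>t. - \<sigma> * cos t"])
    show "- \<sigma> * cos t = \<sigma> * cos ((4 * real q + 1) * t + 4 * p) +
        - 2 * \<sigma> * cos ((2 * real q + 1) * t + 2 * p) * (2 * (cos (real q * t + p))\<^sup>2 - 1)" for t
      unfolding lissajous_cos_identity right_diff_distrib by simp
    show "ambient_isotopic (range (\<lambda>t. vector [- \<sigma> * cos t, cos ((2 * real q + 1) * t + 2 * p),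
        cos (real q * t + p)])) unknot"
    proof (rule ambient_isotopic_shear_2[where h = "\<lambda>x z. - cos (2 * p) * T2 (- \<sigma> * x)"
          and w = "\<lambda>t. - ?s * sin ((2 * real q + 1) * t)"])
      show "- ?s * sin ((2 * real q + 1) * t) = cos ((2 * real q + 1) * t + 2 * p) +
          - cos (2 * p) * T2 (- \<sigma> * (- \<sigma> * cos t))" for t
        unfolding cos_eq cos_add T2' by simp
      show "ambient_isotopic (range (\<lambda>t. vector [- \<sigma> * cos t, - ?s * sin ((2 * real q + 1) * t),
          cos (real q * t + p)])) unknot"
      proof (rule ambient_isotopic_shear_3[where h = "\<lambda>x y. - cos p * T (- \<sigma> * x)"
            and w = "\<lambda>t. - sin p * sin (real q * t)"])
        show "- sin p * sin (real q * t) = cos (real q * t + p) + - cos p * T (- \<sigma> * (- \<sigma> * cos t))" for t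
          unfolding cos_eq cos_add TU(3) by simp
        show "ambient_isotopic (range (\<lambda>t. vector [- \<sigma> * cos t, - ?s * sin ((2 * real q + 1) * t),
            - sin p * sin (real q * t)])) unknot"
        proof (rule ambient_isotopic_shear_2[where h = "\<lambda>x z. - (2 * ?s / sin p) * z * T1 (- \<sigma> * x)"
              and w = "\<lambda>t. - ?s * sin t"])
          show "- ?s * sin t = - ?s * sin ((2 * real q + 1) * t) +
              - (2 * ?s / sin p) * (- sin p * sin (real q * t)) * T1 (- \<sigma> * (- \<sigma> * cos t))" for t
            unfolding cos_eq sin_odd_multiple_angle T1' using p1 by (simp add: distrib_left)
          show "ambient_isotopic (range (\<lambda>t. vector [- \<sigma> * cos t, - ?s * sin t,
              - sin p * sin (real q * t)])) unknot"
          proof (rule ambient_isotopic_shear_3[where h = "\<lambda>x y. - (sin p / ?s) * y * U (- \<sigma> * x)"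
                and w = "\<lambda>t. 0"])
            show "0 = - sin p * sin (real q * t) + - (sin p / ?s) * (- ?s * sin t) * U (- \<sigma> * (- \<sigma> * cos t))" for t
              unfolding cos_eq TU(4) using p by simp
            show "ambient_isotopic (range (\<lambda>t. vector [- \<sigma> * cos t, - ?s * sin t, 0])) unknot"
              using \<sigma> p by (intro ellipse_unknot) auto
          qed (intro continuous_intros comp TU)
        qed (intro continuous_intros comp T1)
      qed (intro continuous_intros comp TU)
    qed (intro continuous_intros comp T2)
  qed (intro continuous_intros)
qed

text \<open>The shears above express \<open>cos t\<close> and \<open>sin t\<close> through the point of the curve, so the point determines the parameter
modulo \<open>2\<pi>\<close>.\<close>

lemma lissajous_inj:
  assumes \<sigma>: "\<bar>\<sigma>\<bar> = 1" and p: "sin (2 * p) \<noteq> 0"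
    and eq: "lissajous q \<sigma> p s = lissajous q \<sigma> p t"
  shows "sin s = sin t" and "cos s = cos t"
proof -
  have p1: "sin p \<noteq> 0" using p by (auto simp: sin_double)
  have 1: "cos ((4 * real q + 1) * s + 4 * p) = cos ((4 * real q + 1) * t + 4 * p)"
    and 2: "cos ((2 * real q + 1) * s + 2 * p) = cos ((2 * real q + 1) * t + 2 * p)"
    and 3: "cos (real q * s + p) = cos (real q * t + p)"
    using eq \<sigma> by (auto simp: lissajous_def vec_eq_iff forall_3)
  show c: "cos s = cos t"
    using lissajous_cos_identity[of q s p] lissajous_cos_identity[of q t p] 1 2 3 by simp
  have cm: "cos (real n * s) = cos (real n * t)" for n
    using c multiple_angle[of n] by metis
  have "sin (real q * s) = sin (real q * t)"
    using 3 cm[of q] p1 by (simp add: cos_add)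
  moreover have "sin ((2 * real q + 1) * s) = sin ((2 * real q + 1) * t)"
    using 2 cm[of "2 * q + 1"] p by (simp add: cos_add add.commute)
  ultimately show "sin s = sin t"
    using sin_odd_multiple_angle[of q s] sin_odd_multiple_angle[of q t] cm[of "q + 1"]
    by (simp add: add.commute)
qed

text \<open>A common critical point of the last two coordinates would be a zero of \<open>sin a\<close> and \<open>sin b\<close> in the notation of
\<open>lissajous_cos_identity\<close>. Then \<open>t = a - 2b\<close> and \<open>p = b - qt\<close> would be multiples of \<open>\<pi>\<close>.\<close>

lemma lissajous_regular:
  assumes p: "sin (2 * p) \<noteq> 0"
    and a: "sin ((2 * real q + 1) * t + 2 * p) = 0" and b: "sin (real q * t + p) = 0"
  shows False
proof -
  have p1: "sin p \<noteq> 0" using p by (auto simp: sin_double)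
  have "t = ((2 * real q + 1) * t + 2 * p) - 2 * (real q * t + p)"
    by (simp add: algebra_simps)
  then have "sin t = sin (((2 * real q + 1) * t + 2 * p) - 2 * (real q * t + p))" by metis
  also have "\<dots> = 0"
    unfolding sin_diff[of "(2 * real q + 1) * t + 2 * p"] sin_double using a b by simp
  finally have "sin (real q * t) = 0"
    using multiple_angle[of q] by (metis mult_zero_left)
  then have "cos (real q * t) * sin p = 0" "cos (real q * t) \<noteq> 0"
    using b sin_zero_abs_cos_one[of "real q * t"] by (auto simp: sin_add)
  then show False using p1 by simp
qed

lemma has_real_derivative_cos_affine:
  "((\<lambda>t. cos (a * (t - c) + b)) has_real_derivative - sin (a * (t - c) + b) * a) (at t)"
  by (auto intro!: derivative_eq_intros)

lemma smooth_embedding_shifted_lissajous: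
  assumes \<sigma>: "\<bar>\<sigma>\<bar> = 1" and p: "sin (2 * p) \<noteq> 0" and q: "q > 0"
  shows "smooth_embedding (\<lambda>t. lissajous q \<sigma> p (t - c))"
proof -
  let ?L = "\<lambda>t. lissajous q \<sigma> p (t - c)"
  have trig: "trig_poly (4 * q + 2) (\<lambda>t. ?L t $ i)" for i
  proof -
    have 1: "?L t $ 1 = \<sigma> * cos (real (4 * q + 1) * t + (4 * p - real (4 * q + 1) * c))" for t
      by (simp add: lissajous_def algebra_simps)
    have 2: "?L t $ 2 = 1 * cos (real (2 * q + 1) * t + (2 * p - real (2 * q + 1) * c))" for t
      by (simp add: lissajous_def algebra_simps)
    have 3: "?L t $ 3 = 1 * cos (real q * t + (p - real q * c))" for t
      by (simp add: lissajous_def algebra_simps)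
    have "trig_poly (4 * q + 2) (\<lambda>t. ?L t $ 1)" "trig_poly (4 * q + 2) (\<lambda>t. ?L t $ 2)"
      "trig_poly (4 * q + 2) (\<lambda>t. ?L t $ 3)"
      unfolding 1 2 3 by (rule trig_poly_harmonic_nat; simp)+
    then show ?thesis
      using exhaust_3[of i] by blast
  qed
  have sm: "smooth ?L" using trig by (rule smooth_trig_poly_curve[where f = ?L and q = "\<lambda>_. 4 * q + 2"])
  have per: "?L (t + 2 * pi) = ?L t" for t
    using trig_poly_periodic[OF trig, of t] by (simp add: vec_eq_iff)
  show ?thesis
    unfolding smooth_embedding_def
  proof (intro conjI allI)
    show "?L (t + 2 * pi) = ?L t" for t by (rule per)
    show "inj_on ?L {0..<2 * pi}"
    proof (rule inj_onI)
      fix s t assume st: "s \<in> {0..<2 * pi}" "t \<in> {0..<2 * pi}" and eq: "?L s = ?L t"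
      have "sin (s - c) = sin (t - c) \<and> cos (s - c) = cos (t - c)"
        using lissajous_inj[OF \<sigma> p eq] by simp
      then obtain n :: int where n: "s - c = t - c + 2 * pi * of_int n"
        using sin_cos_eq_iff by blast
      have "\<bar>s - t\<bar> < 2 * pi" using st by auto
      then have "2 * pi * \<bar>of_int n\<bar> < 2 * pi * 1" using n by (simp add: abs_mult)
      then have "\<bar>of_int n :: real\<bar> < 1" by simp
      then have "n = 0" by simp
      then show "s = t" using n by simp
    qed
    show "vector_derivative ?L (at t) \<noteq> 0" for t
    proof
      assume 0: "vector_derivative ?L (at t) = 0"
      have L0: "(?L has_vector_derivative 0) (at t)"
        using smooth_has_vector_derivative[OF sm, of t] unfolding 0 .
      have "((\<lambda>t. ?L t $ 2) has_real_derivative 0) (at t)"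
        using has_vector_derivative_component[OF L0, of 2] by simp
      moreover have "((\<lambda>t. ?L t $ 2) has_real_derivative
          - sin ((2 * real q + 1) * (t - c) + 2 * p) * (2 * real q + 1)) (at t)"
        unfolding lissajous_def vector_3 by (rule has_real_derivative_cos_affine)
      ultimately have 2: "- sin ((2 * real q + 1) * (t - c) + 2 * p) * (2 * real q + 1) = 0"
        by (metis DERIV_unique)
      have "((\<lambda>t. ?L t $ 3) has_real_derivative 0) (at t)"
        using has_vector_derivative_component[OF L0, of 3] by simp
      moreover have "((\<lambda>t. ?L t $ 3) has_real_derivative - sin (real q * (t - c) + p) * real q) (at t)"
        unfolding lissajous_def vector_3 by (rule has_real_derivative_cos_affine)
      ultimately have 3: "- sin (real q * (t - c) + p) * real q = 0"
        by (metis DERIV_unique)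
      have "2 * real q + 1 \<noteq> 0" "real q \<noteq> 0" using q by auto
      then have "sin ((2 * real q + 1) * (t - c) + 2 * p) = 0" "sin (real q * (t - c) + p) = 0"
        using 2 3 by (simp_all only: mult_eq_0_iff neg_equal_0_iff_equal) simp_all
      then show False by (rule lissajous_regular[OF p])
    qed
  qed (rule sm)
qed

section \<open>Derivatives dominated by their highest frequencies\<close>

definition top_freq :: "nat \<Rightarrow> 3 \<Rightarrow> nat" where
  "top_freq q i = (if i = 1 then 4 * q + 1 else if i = 2 then 2 * q + 1 else q)"

definition top_phase :: "3 \<Rightarrow> real" where
  "top_phase i = (if i = 1 then pi else if i = 2 then pi / 2 else pi / 4)"

text \<open>The curve of the dominating harmonics after \<open>n\<close> differentiations, each coordinate divided by the \<open>n\<close>th power of its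
frequency. The phases for \<open>n = 0\<close> are \<open>4p\<close>, \<open>2p\<close>, \<open>p\<close> with \<open>p = \<pi>/4\<close>: differentiation moves \<open>p\<close> by multiples
of \<open>\<pi>/2\<close>, so \<open>2p\<close> never becomes a multiple of \<open>\<pi>\<close>.\<close>

definition top_curve :: "nat \<Rightarrow> nat \<Rightarrow> real \<Rightarrow> real^3" where
  "top_curve q n t = (\<chi> i. cos (real (top_freq q i) * t + (top_phase i + real n * pi / 2)))"

definition lissajous_phase :: "nat \<Rightarrow> nat \<Rightarrow> real" where
  "lissajous_phase q n = pi / 4 + (real q + 1) * (real n * pi / 2)"

text \<open>Translating the parameter by \<open>n\<pi>/2\<close> absorbs the phase shift in the slowest combination \<open>a - 2b = t\<close>; the other two
angles keep the ratio of their phases, and the first angle is off by \<open>n\<pi>\<close>, which gives the sign.\<close>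

lemma top_curve_eq_lissajous:
  "top_curve q n t = lissajous q ((-1) ^ n) (lissajous_phase q n) (t - real n * pi / 2)"
proof -
  define h where "h = real n * pi / 2"
  have arg1: "(4 * real q + 1) * (t - h) + 4 * (pi / 4 + (real q + 1) * h)
      = ((4 * real q + 1) * t + (pi + h)) + 2 * h"
    and arg2: "(2 * real q + 1) * (t - h) + 2 * (pi / 4 + (real q + 1) * h)
      = (2 * real q + 1) * t + (pi / 2 + h)"
    and arg3: "real q * (t - h) + (pi / 4 + (real q + 1) * h) = real q * t + (pi / 4 + h)"
    by (simp_all add: algebra_simps)
  have "2 * h = real n * pi" by (simp add: h_def)
  then have sign: "(-1) ^ n * cos (x + 2 * h) = cos x" for x
    by (simp add: cos_add flip: mult.assoc power_mult_distrib)
  have "lissajous q ((-1) ^ n) (lissajous_phase q n) (t - h) $ i = top_curve q n t $ i" for i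
    unfolding lissajous_def lissajous_phase_def h_def[symmetric] arg1 arg2 arg3 sign
    using exhaust_3[of i] by (auto simp: top_curve_def top_freq_def top_phase_def h_def add.commute)
  then show ?thesis by (simp add: vec_eq_iff h_def)
qed

lemma sin_lissajous_phase: "sin (2 * lissajous_phase q n) \<noteq> 0"
proof -
  have "2 * lissajous_phase q n = pi / 2 + real ((q + 1) * n) * pi"
    by (simp add: lissajous_phase_def field_simps)
  then show ?thesis
    using cos_npi[of "(q + 1) * n"] by (simp only: sin_add) simp
qed

lemma top_curve_unknot: "ambient_isotopic (range (top_curve q n)) unknot"
proof -
  let ?L = "lissajous q ((-1) ^ n) (lissajous_phase q n)"
  have "range (\<lambda>t. t - real n * pi / 2) = UNIV"
    by (rule surjI[of _ "\<lambda>t. t + real n * pi / 2"]) simp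
  then have "range ?L = ?L ` range (\<lambda>t. t - real n * pi / 2)" by simp
  also have "\<dots> = range (\<lambda>t. top_curve q n t)"
    unfolding image_image top_curve_eq_lissajous ..
  finally show ?thesis
    using lissajous_unknot[OF _ sin_lissajous_phase, of "(-1) ^ n" q q n] by (simp add: power_abs)
qed

lemma smooth_embedding_top_curve: "q > 0 \<Longrightarrow> smooth_embedding (top_curve q n)"
  unfolding top_curve_eq_lissajous[abs_def]
  by (rule smooth_embedding_shifted_lissajous) (auto simp: power_abs sin_lissajous_phase)

text \<open>Only four limit curves occur, so one bound on the distance to the limit curve suffices for all \<open>n\<close>.\<close>

lemma top_curve_mod_4: "top_curve q (n mod 4) = top_curve q n"
proof -
  have "cos (x + (y + real n * pi / 2)) = cos (x + (y + real (n mod 4) * pi / 2))" for x y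
  proof -
    have "real n = real (4 * (n div 4) + n mod 4)" by simp
    also have "\<dots> = 4 * real (n div 4) + real (n mod 4)" by (simp only: of_nat_add of_nat_mult of_nat_numeral)
    finally have "x + (y + real n * pi / 2)
        = (x + (y + real (n mod 4) * pi / 2)) + real (2 * (n div 4)) * pi"
      by (simp add: field_simps)
    then show ?thesis by (simp only: cos_add cos_npi sin_npi power_mult) simp
  qed
  then show ?thesis by (simp add: top_curve_def fun_eq_iff)
qed

lemma top_curve_derivative:
  "(top_curve q n has_vector_derivative (\<chi> i. real (top_freq q i) * top_curve q (Suc n) t $ i)) (at t)"
proof (rule has_vector_derivative_componentwise)
  fix i
  let ?x = "real (top_freq q i) * t + (top_phase i + real n * pi / 2)"
  have "real (top_freq q i) * t + (top_phase i + real (Suc n) * pi / 2) = ?x + pi / 2"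
    by (simp add: field_simps)
  then have "cos (real (top_freq q i) * t + (top_phase i + real (Suc n) * pi / 2)) = - sin ?x"
    by (simp only: cos_add) simp
  then show "((\<lambda>t. top_curve q n t $ i) has_real_derivative
      (\<chi> i. real (top_freq q i) * top_curve q (Suc n) t $ i) $ i) (at t)"
    unfolding top_curve_def by (auto intro!: derivative_eq_intros)
qed

text \<open>The harmonics in the coordinates of \<open>P\<close> have frequencies below \<open>q\<close>, and the added ones have frequencies \<open>w \<ge> q\<close>. After
dividing the \<open>n\<close>th derivative by \<open>\<epsilon> w\<^sup>n\<close> coordinatewise, the contribution of \<open>P\<close> decays like
\<open>((q - 1) / w)\<^sup>n\<close>, and what remains is \<open>top_curve q n\<close>.\<close>

lemma dominated_derivatives_unknotted:
  fixes P :: "real \<Rightarrow> real^3"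
  assumes P: "\<And>i. trig_poly q (\<lambda>t. P t $ i)" and q: "q > 0" and \<epsilon>: "\<epsilon> > 0"
  shows "derivative_knots_converge_to (\<lambda>t. P t + \<epsilon> *\<^sub>R top_curve q 0 t) unknot"
proof -
  have "\<exists>D C. D 0 = (\<lambda>t. P t $ i) \<and> (\<forall>n t. (D n has_real_derivative D (Suc n) t) (at t)) \<and>
      (\<forall>n t. D n (t + 2 * pi) = D n t) \<and> (\<forall>n t. \<bar>D n t\<bar> \<le> C * (real q - 1) ^ n)" for i
    using trig_poly_derivatives[OF P[of i]] .
  then obtain D C where D0: "\<And>i. D i 0 = (\<lambda>t. P t $ i)"
    and D: "\<And>i n t. (D i n has_real_derivative D i (Suc n) t) (at t)"
    and Dper: "\<And>i n t. D i n (t + 2 * pi) = D i n t"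
    and Dbound: "\<And>i n t. \<bar>D i n t\<bar> \<le> C i * (real q - 1) ^ n"
    by metis
  define w where "w i = real (top_freq q i)" for i
  have w: "w i > 0" "real q \<le> w i" for i
    using q by (auto simp: w_def top_freq_def)
  have top_der: "((\<lambda>t. top_curve q n t $ i) has_real_derivative w i * top_curve q (Suc n) t $ i) (at t)" for n i t
    using has_vector_derivative_component[OF top_curve_derivative, of q n i] by (simp add: w_def)
  have top_per: "top_curve q n (t + 2 * pi) = top_curve q n t" for n t
    using smooth_embedding_top_curve[OF q] unfolding smooth_embedding_def by blast

  define F where "F n t = (\<chi> i. D i n t + \<epsilon> * (w i ^ n * top_curve q n t $ i))" for n t
  have F: "(F n has_vector_derivative F (Suc n) t) (at t)" for n t
    unfolding F_def
  proof (rule has_vector_derivative_componentwise, unfold vec_lambda_beta)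
    fix i
    have "((\<lambda>t. D i n t + \<epsilon> * (w i ^ n * top_curve q n t $ i)) has_real_derivative
        D i (Suc n) t + \<epsilon> * (w i ^ n * (w i * top_curve q (Suc n) t $ i))) (at t)"
      by (intro DERIV_add DERIV_cmult D top_der)
    then show "((\<lambda>t. D i n t + \<epsilon> * (w i ^ n * top_curve q n t $ i)) has_real_derivative
        D i (Suc n) t + \<epsilon> * (w i ^ Suc n * top_curve q (Suc n) t $ i)) (at t)"
      by (simp add: mult.assoc mult.left_commute)
  qed
  have Fper: "F n (t + 2 * pi) = F n t" for n t
    by (simp add: F_def Dper top_per)
  have F0: "F 0 = (\<lambda>t. P t + \<epsilon> *\<^sub>R top_curve q 0 t)"
    by (simp add: F_def D0 fun_eq_iff vec_eq_iff)
  have nth: "nth_derivative n (\<lambda>t. P t + \<epsilon> *\<^sub>R top_curve q 0 t) = F n" for n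
    using nth_derivative_family[of F n 0, OF F] by (simp add: F0)
  have Fsm: "smooth (F n)" for n
    using F by (rule smooth_family)

  define c where "c n i = 1 / (\<epsilon> * w i ^ n)" for n i
  have c: "c n i > 0" for n i using \<epsilon> w by (simp add: c_def)
  \<comment> \<open>The scaling factors of the nth derivative are applied to all derivatives, so that the derivative of the scaled curve lies in the same family.\<close>
  define G where "G n m t = (\<chi> i. c n i * F m t $ i)" for n m t
  have G: "(G n m has_vector_derivative G n (Suc m) t) (at t)" for n m t
    unfolding G_def
    by (rule has_vector_derivative_componentwise, unfold vec_lambda_beta)
      (rule DERIV_cmult[OF has_vector_derivative_component[OF F]])
  have Gsm: "smooth (G n m)" for n m
    using G by (rule smooth_family)
  have Gper: "G n m (t + 2 * pi) = G n m t" for n m t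
    by (simp add: G_def Fper)
  have G_diff: "G n (Suc n) t $ i - w i * top_curve q (Suc n) t $ i = c n i * D i (Suc n) t" for n t i
    using \<epsilon> w[of i] by (simp add: G_def F_def c_def field_simps)

  have "\<exists>\<eta>>0. \<forall>f. (\<forall>t. f (t + 2 * pi) = f t) \<longrightarrow> smooth f \<longrightarrow>
      (\<forall>t. norm (vector_derivative f (at t) - vector_derivative (top_curve q n) (at t)) \<le> \<eta>) \<longrightarrow>
      parametrisation_of f (range (top_curve q n))" for n
    by (rule C1_close_to_embedding[OF smooth_embedding_top_curve[OF q, of n]]) blast
  then obtain \<eta> where \<eta>: "\<And>n. \<eta> n > 0"
    and close: "\<And>n f. (\<And>t. f (t + 2 * pi) = f t) \<Longrightarrow> smooth f \<Longrightarrow>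
      (\<And>t. norm (vector_derivative f (at t) - vector_derivative (top_curve q n) (at t)) \<le> \<eta> n) \<Longrightarrow>
      parametrisation_of f (range (top_curve q n))"
    by metis
  define \<eta>0 where "\<eta>0 = Min (\<eta> ` {..<4::nat})"
  have \<eta>0: "\<eta>0 > 0"
    unfolding \<eta>0_def by (subst Min_gr_iff) (use \<eta> in \<open>auto simp: lessThan_empty_iff\<close>)
  have \<eta>0_le: "\<eta>0 \<le> \<eta> (n mod 4)" for n :: nat
    unfolding \<eta>0_def by (intro Min_le) auto

  have lim: "(\<lambda>n. c n i * (C i * (real q - 1) ^ Suc n)) \<longlonglongrightarrow> 0" for i
  proof -
    have "(\<lambda>n. (C i * (real q - 1) / \<epsilon>) * ((real q - 1) / w i) ^ n) \<longlonglongrightarrow> (C i * (real q - 1) / \<epsilon>) * 0"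
      using q w[of i] by (intro tendsto_mult_left LIMSEQ_power_zero) (auto simp: field_simps)
    moreover have "(C i * (real q - 1) / \<epsilon>) * ((real q - 1) / w i) ^ n = c n i * (C i * (real q - 1) ^ Suc n)" for n
      by (simp add: c_def power_divide)
    ultimately show ?thesis by simp
  qed
  have "\<forall>\<^sub>F n in sequentially. c n i * (C i * (real q - 1) ^ Suc n) < \<eta>0 / 3" for i
    using order_tendstoD(2)[OF lim[of i], of "\<eta>0 / 3"] \<eta>0 by simp
  then have "\<forall>\<^sub>F n in sequentially. \<forall>i. c n i * (C i * (real q - 1) ^ Suc n) < \<eta>0 / 3"
    by (rule eventually_all_finite)
  then show ?thesis
    unfolding derivative_knots_converge_to_def
  proof (rule eventually_mono)
    fix n assume small: "\<forall>i. c n i * (C i * (real q - 1) ^ Suc n) < \<eta>0 / 3"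
    have diff: "norm (vector_derivative (G n n) (at t) - vector_derivative (top_curve q (n mod 4)) (at t))
        \<le> \<eta> (n mod 4)" for t
    proof -
      have G': "vector_derivative (G n n) (at t) = G n (Suc n) t"
        using G by (rule vector_derivative_at)
      have top': "vector_derivative (top_curve q (n mod 4)) (at t) = (\<chi> i. w i * top_curve q (Suc n) t $ i)"
        unfolding top_curve_mod_4 w_def by (rule vector_derivative_at[OF top_curve_derivative])
      have "norm (G n (Suc n) t - (\<chi> i. w i * top_curve q (Suc n) t $ i))
          \<le> (\<Sum>i\<in>UNIV. \<bar>(G n (Suc n) t - (\<chi> i. w i * top_curve q (Suc n) t $ i)) $ i\<bar>)"
        by (rule norm_le_l1_cart)
      also have "\<dots> \<le> (\<Sum>i\<in>(UNIV :: 3 set). \<eta>0 / 3)"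
      proof (rule sum_mono)
        fix i
        have "\<bar>c n i * D i (Suc n) t\<bar> \<le> c n i * (C i * (real q - 1) ^ Suc n)"
          using mult_left_mono[OF Dbound[of i "Suc n" t], of "c n i"] c[of n i] by (simp add: abs_mult)
        also have "\<dots> \<le> \<eta>0 / 3"
          using small by (intro less_imp_le) (rule spec)
        finally show "\<bar>(G n (Suc n) t - (\<chi> i. w i * top_curve q (Suc n) t $ i)) $ i\<bar> \<le> \<eta>0 / 3"
          using G_diff[of n t i] by simp
      qed
      also have "\<dots> \<le> \<eta> (n mod 4)" using \<eta>0_le[of n] by simp
      finally show ?thesis unfolding G' top' .
    qed
    have par: "parametrisation_of (G n n) (range (top_curve q n))"
      using close[of "G n n" "n mod 4"] Gper Gsm diff by (simp add: top_curve_mod_4)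
    have "smooth_embedding (F n)"
      using Fper Fsm
    proof (rule smooth_embedding_of_scaled)
      show "smooth_embedding (\<lambda>t. \<chi> i. c n i * F n t $ i)"
        using par unfolding parametrisation_of_def G_def by simp
    qed
    moreover have "ambient_isotopic (range (F n)) unknot"
    proof -
      have "ambient_isotopic (range (F n)) ((\<lambda>x. \<chi> i. (\<chi> j. c n j) $ i * x $ i) ` range (F n))"
        by (rule ambient_isotopic_scale) (simp add: c)
      also have "(\<lambda>x. \<chi> i. (\<chi> j. c n j) $ i * x $ i) ` range (F n) = range (G n n)"
        by (simp add: image_image G_def)
      finally show ?thesis
        using par top_curve_unknot unfolding parametrisation_of_def by (meson ambient_isotopic_trans)
    qed
    ultimately show "parametrisation_of (nth_derivative n (\<lambda>t. P t + \<epsilon> *\<^sub>R top_curve q 0 t)) unknot"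
      unfolding nth parametrisation_of_def ..
  qed
qed

theorem corollary4p4:
  fixes K :: "(real ^ 3) set"
  assumes "knot K"
  shows "\<exists>f. parametrisation_of f K \<and> derivative_knots_converge_to f unknot"
proof -
  obtain g where emb: "smooth_embedding g" and K: "range g = K"
    using assms unfolding knot_def by blast
  define g' where "g' t = vector_derivative g (at t)" for t
  have per: "\<And>t. g (t + 2 * pi) = g t" and sm: "smooth g"
    using emb unfolding smooth_embedding_def by auto
  obtain \<eta> where \<eta>: "\<eta> > 0"
    and close: "\<And>f. (\<And>t. f (t + 2 * pi) = f t) \<Longrightarrow> smooth f \<Longrightarrow>
      (\<And>t. norm (vector_derivative f (at t) - vector_derivative g (at t)) \<le> \<eta>) \<Longrightarrow>
      parametrisation_of f (range g)"
    by (rule C1_close_to_embedding[OF emb]) blast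

  have "\<exists>q p p'. trig_poly q p \<and> (\<forall>t. (p has_real_derivative p' t) (at t)) \<and>
      (\<forall>t. \<bar>p' t - g' t $ i\<bar> \<le> \<eta> / 6)" for i
  proof (rule trig_poly_dense_C1[of "\<lambda>t. g t $ i" "\<lambda>t. g' t $ i" "\<eta> / 6"])
    show "((\<lambda>t. g t $ i) has_real_derivative g' t $ i) (at t)" for t
      unfolding g'_def by (rule has_vector_derivative_component[OF smooth_has_vector_derivative[OF sm]])
    show "continuous_on UNIV (\<lambda>t. g' t $ i)"
      unfolding g'_def by (intro continuous_on_component smooth_continuous_vector_derivative[OF sm])
  qed (use per \<eta> in auto)
  then obtain r p p' where p: "\<And>i :: 3. trig_poly (r i) (p i)"
    and p_der: "\<And>i t. (p i has_real_derivative p' i t) (at t)"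
    and p_close: "\<And>i t. \<bar>p' i t - g' t $ i\<bar> \<le> \<eta> / 6"
    by metis
  define q where "q = Suc (Max (range r))"
  have r_le: "r i \<le> q" for i by (simp add: q_def le_SucI)
  have pq: "trig_poly q (p i)" for i
    using p r_le by (rule trig_poly_mono)
  \<comment> \<open>The largest frequency is 4 q + 1, so the added harmonics change each coordinate of the derivative by at most a sixth of the tolerance; the approximation error takes up another sixth.\<close>
  define \<epsilon> where "\<epsilon> = \<eta> / (6 * (4 * real q + 1))"
  have \<epsilon>: "\<epsilon> > 0" using \<eta> by (simp add: \<epsilon>_def)
  define P where "P t = (\<chi> i. p i t)" for t
  define f where "f t = P t + \<epsilon> *\<^sub>R top_curve q 0 t" for t

  have f_der: "(f has_vector_derivative
      (\<chi> i. p' i t + \<epsilon> * (real (top_freq q i) * top_curve q 1 t $ i))) (at t)" for t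
  proof (rule has_vector_derivative_componentwise)
    fix i
    have "((\<lambda>t. top_curve q 0 t $ i) has_real_derivative real (top_freq q i) * top_curve q 1 t $ i) (at t)"
      using has_vector_derivative_component[OF top_curve_derivative, of q 0 i] by simp
    then have "((\<lambda>t. p i t + \<epsilon> * top_curve q 0 t $ i) has_real_derivative
        p' i t + \<epsilon> * (real (top_freq q i) * top_curve q 1 t $ i)) (at t)"
      by (intro DERIV_add DERIV_cmult p_der)
    then show "((\<lambda>t. f t $ i) has_real_derivative
        (\<chi> i. p' i t + \<epsilon> * (real (top_freq q i) * top_curve q 1 t $ i)) $ i) (at t)"
      by (simp add: f_def P_def)
  qed
  have f_trig: "trig_poly (4 * q + 2) (\<lambda>t. f t $ i)" for i
  proof -
    have "trig_poly (4 * q + 2) (\<lambda>t. p i t + \<epsilon> * cos (real (top_freq q i) * t + (top_phase i + real 0 * pi / 2)))"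
      by (intro trig_poly.add trig_poly_mono[OF pq] trig_poly_harmonic_nat) (auto simp: top_freq_def)
    then show ?thesis by (simp add: f_def P_def top_curve_def)
  qed
  have "parametrisation_of f (range g)"
  proof (rule close, fold g'_def)
    show "f (t + 2 * pi) = f t" for t
      using trig_poly_periodic[OF f_trig] by (simp add: vec_eq_iff)
    show "smooth f"
      using f_trig by (rule smooth_trig_poly_curve[where q = "\<lambda>_. 4 * q + 2"])
    show "norm (vector_derivative f (at t) - g' t) \<le> \<eta>" for t
    proof -
      have comp: "\<bar>p' i t + \<epsilon> * (real (top_freq q i) * top_curve q 1 t $ i) - g' t $ i\<bar> \<le> \<eta> / 3" for i
      proof -
        have "real (top_freq q i) * \<bar>top_curve q 1 t $ i\<bar> \<le> (4 * real q + 1) * 1"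
          by (intro mult_mono) (auto simp: top_freq_def top_curve_def)
        then have "\<epsilon> * (real (top_freq q i) * \<bar>top_curve q 1 t $ i\<bar>) \<le> \<epsilon> * ((4 * real q + 1) * 1)"
          using \<epsilon> by (intro mult_left_mono) auto
        also have "\<dots> = \<eta> / 6"
        proof -
          have cancel: "\<eta> / (6 * N) * (N * 1) = \<eta> / 6" if "N > 0" for N
            using that by simp
          show ?thesis unfolding \<epsilon>_def by (rule cancel) simp
        qed
        finally have "\<bar>\<epsilon> * (real (top_freq q i) * top_curve q 1 t $ i)\<bar> \<le> \<eta> / 6"
          using \<epsilon> by (simp add: abs_mult)
        then show ?thesis using p_close[of i t] by linarith
      qed
      have "norm (vector_derivative f (at t) - g' t) \<le> (\<Sum>i\<in>UNIV. \<bar>(vector_derivative f (at t) - g' t) $ i\<bar>)"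
        by (rule norm_le_l1_cart)
      also have "\<dots> \<le> (\<Sum>i\<in>(UNIV :: 3 set). \<eta> / 3)"
        by (rule sum_mono) (use comp in \<open>simp add: vector_derivative_at[OF f_der]\<close>)
      finally show ?thesis by simp
    qed
  qed
  moreover have "derivative_knots_converge_to f unknot"
    unfolding f_def
    by (rule dominated_derivatives_unknotted) (use pq \<epsilon> in \<open>auto simp: P_def q_def\<close>)
  ultimately show ?thesis using K by blast
qed

end
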